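(* Let $G$ be a $\sigma$-compact locally compact Abelian group and $\Lambda\subset G$ an almost lattice. Then $\Lambda$ is a subset of a model set.
   Context: $\Lambda$ is an almost lattice if it is relatively dense, locally finite, and there is a finite set $F$ with $\Lambda-\Lambda\subset\Lambda+F$. A cut and project scheme $(G\times H,\widetilde L)$: $H$ a locally compact Abelian group, $\widetilde L\subset G\times H$ a discrete cocompact subgroup with $\pi_1|_{\widetilde L}$ injective and $\pi_2(\widetilde L)$ dense; $x^\star:=\pi_2((\pi_1|_{\widetilde L})^{-1}(x))$. A model set is $\Lambda(W):=\{x\in\pi_1(\widetilde L):x^\star\in W\}$ with $W\subset H$ precompact with nonempty interior. *)

theory Defs
  imports "HOL-Analysis.Analysis"
begin

definition sigma_compact_group :: "'a::topological_space itself \<Rightarrow> bool" where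
  "sigma_compact_group _ \<longleftrightarrow>
     (\<exists>K :: nat \<Rightarrow> 'a set. (\<forall>n. compact (K n)) \<and> (\<Union>n. K n) = UNIV)"

definition relatively_dense :: "'a::{topological_space, ab_group_add} set \<Rightarrow> bool" where
  "relatively_dense \<Lambda> \<longleftrightarrow> (\<exists>K. compact K \<and> {x + k | x k. x \<in> \<Lambda> \<and> k \<in> K} = UNIV)"

definition locally_finite_set :: "'a::topological_space set \<Rightarrow> bool" where
  "locally_finite_set \<Lambda> \<longleftrightarrow> (\<forall>K. compact K \<longrightarrow> finite (\<Lambda> \<inter> K))"

definition almost_lattice :: "'a::{topological_space, ab_group_add} set \<Rightarrow> bool" where
  "almost_lattice \<Lambda> \<longleftrightarrow> relatively_dense \<Lambda> \<and> locally_finite_set \<Lambda> \<and>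
     (\<exists>F. finite F \<and> {x - y | x y. x \<in> \<Lambda> \<and> y \<in> \<Lambda>} \<subseteq> {x + f | x f. x \<in> \<Lambda> \<and> f \<in> F})"

definition lca_group :: "'h topology \<Rightarrow> ('h \<Rightarrow> 'h \<Rightarrow> 'h) \<Rightarrow> 'h \<Rightarrow> ('h \<Rightarrow> 'h) \<Rightarrow> bool" where
  "lca_group T add zero neg \<longleftrightarrow>
     zero \<in> topspace T \<and>
     (\<forall>x\<in>topspace T. \<forall>y\<in>topspace T. add x y \<in> topspace T) \<and>
     (\<forall>x\<in>topspace T. neg x \<in> topspace T) \<and>
     (\<forall>x\<in>topspace T. \<forall>y\<in>topspace T. \<forall>z\<in>topspace T. add (add x y) z = add x (add y z)) \<and>
     (\<forall>x\<in>topspace T. \<forall>y\<in>topspace T. add x y = add y x) \<and>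
     (\<forall>x\<in>topspace T. add zero x = x) \<and>
     (\<forall>x\<in>topspace T. add (neg x) x = zero) \<and>
     Hausdorff_space T \<and> locally_compact_space T \<and>
     continuous_map (prod_topology T T) T (\<lambda>(x, y). add x y) \<and>
     continuous_map T T neg"

text \<open>A cut and project scheme (G x H, L) with G the ambient type 'a and H the
  LCA group (T, add, zero, neg). Cocompactness of the discrete subgroup L is
  expressed by the existence of a compact K with K + L = G x H.\<close>

definition cut_and_project ::
  "'h topology \<Rightarrow> ('h \<Rightarrow> 'h \<Rightarrow> 'h) \<Rightarrow> 'h \<Rightarrow> ('h \<Rightarrow> 'h) \<Rightarrow>
   ('a::{topological_space, ab_group_add} \<times> 'h) set \<Rightarrow> bool" where
  "cut_and_project T add zero neg L \<longleftrightarrow>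
     lca_group T add zero neg \<and>
     L \<subseteq> UNIV \<times> topspace T \<and>
     (0, zero) \<in> L \<and>
     (\<forall>p\<in>L. \<forall>q\<in>L. (fst p + fst q, add (snd p) (snd q)) \<in> L) \<and>
     (\<forall>p\<in>L. (- fst p, neg (snd p)) \<in> L) \<and>
     subtopology (prod_topology euclidean T) L = discrete_topology L \<and>
     (\<exists>K. compactin (prod_topology euclidean T) K \<and>
          {(fst k + fst l, add (snd k) (snd l)) | k l. k \<in> K \<and> l \<in> L} = UNIV \<times> topspace T) \<and>
     inj_on fst L \<and>
     T closure_of (snd ` L) = topspace T"

definition star :: "('a \<times> 'h) set \<Rightarrow> 'a \<Rightarrow> 'h" where
  "star L x = snd (the_inv_into L fst x)"

definition model_set :: "('a \<times> 'h) set \<Rightarrow> 'h set \<Rightarrow> 'a set" where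
  "model_set L W = {x \<in> fst ` L. star L x \<in> W}"

definition admissible_window :: "'h topology \<Rightarrow> 'h set \<Rightarrow> bool" where
  "admissible_window T W \<longleftrightarrow>
     W \<subseteq> topspace T \<and> compactin T (T closure_of W) \<and> T interior_of W \<noteq> {}"

end

theory Submission
  imports Defs "HOL-Real_Asymp.Real_Asymp"
begin

text \<open>The difference set \<open>A = \<Lambda> - \<Lambda>\<close> is an approximate subgroup. Since finitely generated
  abelian groups have polynomial growth, the subsets of \<open>A + A + A + A\<close> carry a
  translation-invariant finitely additive probability, and the argument of Massicot and
  Wagner produces a symmetric \<open>S\<close>, finitely many translates of which cover \<open>A\<close>, whose
  eightfold sum lies in the fourfold sum of \<open>A\<close>. Iterating this gives a seminorm on \<open>G\<close> whose
  ball of radius \<open>1/2\<close> is locally finite in \<open>G\<close> and totally bounded for the seminorm. The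
  completion \<open>H\<close> of \<open>G\<close> for the seminorm is locally compact, and the graph of \<open>G \<rightarrow> H\<close> is the
  lattice of the required cut and project scheme.\<close>

section \<open>Coverings by finitely many translates\<close>

definition covered_by_translates :: "'a::comm_monoid_add set \<Rightarrow> 'a set \<Rightarrow> bool" where
  "covered_by_translates A B \<longleftrightarrow> (\<exists>F. finite F \<and> A \<subseteq> B + F)"

lemma covered_by_translates_subset: "A \<subseteq> B \<Longrightarrow> covered_by_translates A B"
  unfolding covered_by_translates_def by (intro exI[of _ "{0}"]) simp

lemma covered_by_translates_trans:
  assumes "covered_by_translates A B" "covered_by_translates B C"
  shows "covered_by_translates A C"
proof -
  obtain F G where "finite F" "A \<subseteq> B + F" "finite G" "B \<subseteq> C + G"
    using assms by (auto simp: covered_by_translates_def)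
  then have "A \<subseteq> (C + G) + F"
    using set_plus_mono2[of B "C + G" F F] by blast
  then have "A \<subseteq> C + (G + F)" by (simp only: add.assoc)
  with \<open>finite F\<close> \<open>finite G\<close> show ?thesis
    unfolding covered_by_translates_def by (blast intro: finite_set_plus)
qed

lemma covered_by_translates_plus:
  assumes "covered_by_translates A B" "covered_by_translates A' B'"
  shows "covered_by_translates (A + A') (B + B')"
proof -
  obtain F F' where F: "finite F" "A \<subseteq> B + F" "finite F'" "A' \<subseteq> B' + F'"
    using assms by (auto simp: covered_by_translates_def)
  have "A + A' \<subseteq> (B + F) + (B' + F')"
    by (intro set_plus_mono2 F)
  also have "\<dots> = (B + B') + (F + F')" by (simp add: ac_simps)
  finally show ?thesis
    using F unfolding covered_by_translates_def by (blast intro: finite_set_plus)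
qed

lemma covered_by_translates_plus_finite: "finite F \<Longrightarrow> covered_by_translates (B + F) B"
  by (auto simp: covered_by_translates_def)

text \<open>A maximal \<open>S\<close>-separated subset of \<open>A\<close> gives the translations.\<close>

lemma covered_by_translates_of_separated_bound:
  fixes A S :: "'a::ab_group_add set"
  assumes "0 \<in> S" and symmetric: "\<And>x. x \<in> S \<Longrightarrow> - x \<in> S"
    and bound: "\<And>Y. Y \<subseteq> A \<Longrightarrow> finite Y \<Longrightarrow> pairwise (\<lambda>x y. x - y \<notin> S) Y \<Longrightarrow> real (card Y) \<le> C"
  shows "covered_by_translates A S"
proof -
  define separated where "separated Y \<longleftrightarrow> Y \<subseteq> A \<and> finite Y \<and> pairwise (\<lambda>x y. x - y \<notin> S) Y" for Y
  have "separated {}" by (simp add: separated_def)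
  moreover have "card Y < nat \<lceil>C\<rceil> + 1" if "separated Y" for Y
    using bound[of Y] that unfolding separated_def by linarith
  ultimately obtain Z where Z: "separated Z" and maximal: "\<And>Y. separated Y \<Longrightarrow> card Y \<le> card Z"
    using ex_has_greatest_nat[of separated "{}" card] by (metis less_imp_le)
  have "a \<in> S + Z" if "a \<in> A" for a
  proof (cases "a \<in> Z")
    case True
    then show ?thesis using \<open>0 \<in> S\<close> by (metis add_0 set_plus_intro)
  next
    case False
    have "\<not> separated (insert a Z)"
      using maximal[of "insert a Z"] False Z by (auto simp: separated_def)
    then obtain z where "z \<in> Z" "a - z \<in> S \<or> z - a \<in> S"
      using Z \<open>a \<in> A\<close> by (auto simp: separated_def pairwise_insert)
    then have "a - z \<in> S" using symmetric[of "z - a"] by auto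
    then show ?thesis using \<open>z \<in> Z\<close> by (metis diff_add_cancel set_plus_intro)
  qed
  then show ?thesis using Z unfolding covered_by_translates_def separated_def by blast
qed

section \<open>Approximate subgroups\<close>

definition difference_set :: "'a::ab_group_add set \<Rightarrow> 'a set" where
  "difference_set A = {x - y | x y. x \<in> A \<and> y \<in> A}"

lemma difference_setI: "x \<in> A \<Longrightarrow> y \<in> A \<Longrightarrow> x - y \<in> difference_set A"
  by (auto simp: difference_set_def)

lemma difference_setE:
  assumes "t \<in> difference_set A"
  obtains x y where "x \<in> A" "y \<in> A" "t = x - y"
  using assms by (auto simp: difference_set_def)

lemma difference_set_mono: "A \<subseteq> B \<Longrightarrow> difference_set A \<subseteq> difference_set B"
  by (auto simp: difference_set_def)

lemma finite_difference_set: "finite A \<Longrightarrow> finite (difference_set A)"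
  unfolding difference_set_def by (rule finite_image_set2) auto

lemma uminus_in_difference_set: "x \<in> difference_set A \<Longrightarrow> - x \<in> difference_set A"
  by (auto elim!: difference_setE intro: difference_setI)

lemma difference_set_plus_subset: "difference_set (A + B) \<subseteq> difference_set A + difference_set B"
proof
  fix x assume "x \<in> difference_set (A + B)"
  then obtain a b a' b' where ab: "a \<in> A" "b \<in> B" "a' \<in> A" "b' \<in> B" and "x = (a + b) - (a' + b')"
    by (auto elim!: difference_setE set_plus_elim)
  then have "x = (a - a') + (b - b')" by simp
  then show "x \<in> difference_set A + difference_set B"
    using ab by (simp only: set_plus_intro difference_setI)
qed

lemma difference_set_symmetric:
  assumes "\<And>x. x \<in> A \<Longrightarrow> - x \<in> A"
  shows "difference_set A = A + A"
proof (intro equalityI subsetI)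
  fix t assume "t \<in> difference_set A"
  then obtain x y where "x \<in> A" "y \<in> A" "t = x + - y" by (auto elim: difference_setE)
  then show "t \<in> A + A" using assms by blast
next
  fix t assume "t \<in> A + A"
  then obtain x y where "x \<in> A" "y \<in> A" "t = x - - y" by (auto elim: set_plus_elim)
  then show "t \<in> difference_set A" using assms by (simp only: difference_setI)
qed

definition iterated_sumset :: "nat \<Rightarrow> 'a::comm_monoid_add set \<Rightarrow> 'a set" where
  "iterated_sumset n A = (\<Sum>i<n. A)"

lemma iterated_sumset_0 [simp]: "iterated_sumset 0 A = {0}"
  and iterated_sumset_Suc [simp]: "iterated_sumset (Suc n) A = iterated_sumset n A + A"
  by (simp_all add: iterated_sumset_def)

lemma iterated_sumset_add: "iterated_sumset (m + n) A = iterated_sumset m A + iterated_sumset n A"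
  by (induction n) (simp_all add: add.assoc)

lemma zero_in_iterated_sumset: "0 \<in> A \<Longrightarrow> 0 \<in> iterated_sumset n A"
  by (induction n) (simp_all, metis add_0 set_plus_intro)

lemma iterated_sumset_le_subset:
  assumes "0 \<in> A" "m \<le> n"
  shows "iterated_sumset m A \<subseteq> iterated_sumset n A"
  using set_zero_plus2[OF zero_in_iterated_sumset[OF assms(1)], of "iterated_sumset m A" "n - m"]
    assms(2)
  by (simp flip: iterated_sumset_add)

lemma uminus_in_iterated_sumset:
  fixes A :: "'a::ab_group_add set"
  assumes symmetric: "\<And>x. x \<in> A \<Longrightarrow> - x \<in> A"
  shows "x \<in> iterated_sumset n A \<Longrightarrow> - x \<in> iterated_sumset n A"
proof (induction n arbitrary: x)
  case (Suc n)
  then obtain y a where "y \<in> iterated_sumset n A" "a \<in> A" "x = y + a" by (auto elim: set_plus_elim)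
  then have "- y + - a \<in> iterated_sumset (Suc n) A"
    unfolding iterated_sumset_Suc by (intro set_plus_intro Suc.IH symmetric)
  then show ?case using \<open>x = y + a\<close> by (simp add: add.commute)
qed simp

lemma difference_set_sumset_symmetric:
  assumes "\<And>x. x \<in> A \<Longrightarrow> - x \<in> A"
  shows "difference_set (A + A) = iterated_sumset 4 A"
proof -
  have "- x \<in> A + A" if "x \<in> A + A" for x
    using that uminus_in_difference_set difference_set_symmetric[of A] assms by blast
  then have "difference_set (A + A) = (A + A) + (A + A)"
    by (rule difference_set_symmetric)
  then show ?thesis by (simp add: eval_nat_numeral add.assoc)
qed

definition approximate_subgroup :: "'a::ab_group_add set \<Rightarrow> bool" where
  "approximate_subgroup A \<longleftrightarrow>
     0 \<in> A \<and> (\<forall>x\<in>A. - x \<in> A) \<and> covered_by_translates (A + A) A"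

lemma approximate_subgroup_zero: "approximate_subgroup A \<Longrightarrow> 0 \<in> A"
  and approximate_subgroup_uminus: "approximate_subgroup A \<Longrightarrow> x \<in> A \<Longrightarrow> - x \<in> A"
  by (auto simp: approximate_subgroup_def)

lemma iterated_sumset_covered:
  assumes "approximate_subgroup A"
  shows "covered_by_translates (iterated_sumset n A) A"
proof (induction n)
  case 0
  show ?case
    using approximate_subgroup_zero[OF assms] by (intro covered_by_translates_subset) simp
next
  case (Suc n)
  have "covered_by_translates (iterated_sumset n A + A) (A + A)"
    by (intro covered_by_translates_plus Suc.IH covered_by_translates_subset order_refl)
  then show ?case
    using assms covered_by_translates_trans by (auto simp: approximate_subgroup_def)
qed

lemma approximate_subgroup_of_covering:
  assumes A: "approximate_subgroup A" "covered_by_translates A S"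
    and S: "0 \<in> S" "\<And>x. x \<in> S \<Longrightarrow> - x \<in> S" "S + S \<subseteq> iterated_sumset m A"
  shows "approximate_subgroup S"
  unfolding approximate_subgroup_def
proof (intro conjI ballI S)
  show "covered_by_translates (S + S) S"
    using covered_by_translates_subset[OF S(3)] iterated_sumset_covered[OF A(1)] A(2)
    by (blast intro: covered_by_translates_trans)
qed

lemma approximate_subgroup_difference_set:
  assumes "\<Lambda> \<noteq> {}" "covered_by_translates (difference_set \<Lambda>) \<Lambda>"
  shows "approximate_subgroup (difference_set \<Lambda>)"
  unfolding approximate_subgroup_def
proof (intro conjI ballI)
  show "0 \<in> difference_set \<Lambda>"
    using assms(1) difference_setI by fastforce
  show "- x \<in> difference_set \<Lambda>" if "x \<in> difference_set \<Lambda>" for x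
    using that by (rule uminus_in_difference_set)
  obtain F where F: "finite F" "difference_set \<Lambda> \<subseteq> \<Lambda> + F"
    using assms(2) by (auto simp: covered_by_translates_def)
  have "difference_set \<Lambda> + difference_set \<Lambda> = difference_set (difference_set \<Lambda>)"
    by (intro difference_set_symmetric[symmetric] uminus_in_difference_set)
  also have "\<dots> \<subseteq> difference_set (\<Lambda> + F)"
    by (rule difference_set_mono) (rule F)
  also have "\<dots> \<subseteq> difference_set \<Lambda> + difference_set F"
    by (rule difference_set_plus_subset)
  finally show "covered_by_translates (difference_set \<Lambda> + difference_set \<Lambda>) (difference_set \<Lambda>)"
    using F(1) finite_difference_set unfolding covered_by_translates_def by blast
qed

section \<open>Invariant contents\<close>

locale probability_content =
  fixes U :: "'a set" and \<mu> :: "'a set \<Rightarrow> real"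
  assumes nonneg: "\<And>X. 0 \<le> \<mu> X"
    and full: "\<mu> U = 1"
    and Un_disjoint: "\<And>X Y. X \<subseteq> U \<Longrightarrow> Y \<subseteq> U \<Longrightarrow> X \<inter> Y = {} \<Longrightarrow> \<mu> (X \<union> Y) = \<mu> X + \<mu> Y"
begin

lemma empty_set: "\<mu> {} = 0"
  using Un_disjoint[of "{}" "{}"] by simp

lemma Diff:
  assumes "X \<subseteq> U"
  shows "\<mu> (X - Y) = \<mu> X - \<mu> (X \<inter> Y)"
proof -
  have "\<mu> ((X - Y) \<union> (X \<inter> Y)) = \<mu> (X - Y) + \<mu> (X \<inter> Y)"
    using assms by (intro Un_disjoint) auto
  moreover have "(X - Y) \<union> (X \<inter> Y) = X" by blast
  ultimately show ?thesis by simp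
qed

lemma subset_le:
  assumes "X \<subseteq> Y" "Y \<subseteq> U"
  shows "\<mu> X \<le> \<mu> Y"
  using Diff[OF assms(2), of X] nonneg[of "Y - X"] assms(1) by (simp add: Int_absorb1)

lemma le_1: "X \<subseteq> U \<Longrightarrow> \<mu> X \<le> 1"
  using subset_le[of X U] full by simp

lemma Un:
  assumes "X \<subseteq> U" "Y \<subseteq> U"
  shows "\<mu> (X \<union> Y) = \<mu> X + \<mu> Y - \<mu> (X \<inter> Y)"
proof -
  have "\<mu> (X \<union> (Y - X)) = \<mu> X + \<mu> (Y - X)"
    using assms by (intro Un_disjoint) auto
  then show ?thesis
    using Diff[OF assms(2), of X] by (simp add: Int_commute)
qed

lemma Un_le: "X \<subseteq> U \<Longrightarrow> Y \<subseteq> U \<Longrightarrow> \<mu> (X \<union> Y) \<le> \<mu> X + \<mu> Y"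
  using Un[of X Y] nonneg[of "X \<inter> Y"] by simp

lemma UN_le:
  assumes "finite I" "\<And>i. i \<in> I \<Longrightarrow> X i \<subseteq> U"
  shows "\<mu> (\<Union>i\<in>I. X i) \<le> (\<Sum>i\<in>I. \<mu> (X i))"
  using assms
proof (induction I)
  case empty
  then show ?case by (simp add: empty_set)
next
  case (insert i I)
  then have "\<mu> (X i \<union> (\<Union>j\<in>I. X j)) \<le> \<mu> (X i) + \<mu> (\<Union>j\<in>I. X j)"
    by (intro Un_le) auto
  then show ?case using insert by simp
qed

text \<open>Bonferroni's inequality, with the number of pairs bounded by \<open>n\<^sup>2 / 2\<close>.\<close>

lemma UN_ge:
  assumes "finite I" "c \<ge> 0"
    and "\<And>i. i \<in> I \<Longrightarrow> X i \<subseteq> U" "\<And>i. i \<in> I \<Longrightarrow> \<mu> (X i) = b"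
    and "\<And>i j. i \<in> I \<Longrightarrow> j \<in> I \<Longrightarrow> i \<noteq> j \<Longrightarrow> \<mu> (X i \<inter> X j) \<le> c"
  shows "real (card I) * b - (real (card I))\<^sup>2 / 2 * c \<le> \<mu> (\<Union>i\<in>I. X i)"
  using assms(1,3-5)
proof (induction I)
  case empty
  show ?case by (simp add: empty_set)
next
  case (insert i I)
  let ?V = "\<Union>j\<in>I. X j" and ?n = "real (card I)"
  have "\<mu> (X i \<inter> ?V) = \<mu> (\<Union>j\<in>I. X i \<inter> X j)" by simp
  also have "\<dots> \<le> (\<Sum>j\<in>I. \<mu> (X i \<inter> X j))"
    using insert by (intro UN_le) auto
  also have "\<dots> \<le> (\<Sum>j\<in>I. c)"
    using insert.prems(3) insert.hyps by (intro sum_mono) (metis insertI1 insertI2)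
  finally have overlap: "\<mu> (X i \<inter> ?V) \<le> ?n * c" by simp
  have IH: "?n * b - ?n\<^sup>2 / 2 * c \<le> \<mu> ?V"
    using insert by blast
  have "(?n + 1) * b - (?n + 1)\<^sup>2 / 2 * c = b + (?n * b - ?n\<^sup>2 / 2 * c) - ?n * c - c / 2"
    by (simp add: algebra_simps power2_eq_square add_divide_distrib)
  also have "\<dots> \<le> \<mu> (X i) + \<mu> ?V - \<mu> (X i \<inter> ?V)"
    using IH insert.prems(2)[of i] overlap \<open>c \<ge> 0\<close> by simp
  also have "\<dots> = \<mu> (X i \<union> ?V)"
    using insert by (intro Un[symmetric]) auto
  finally show ?case using insert by (simp add: add.commute)
qed

end

locale translation_invariant_content = probability_content U \<mu>
  for U :: "'a::ab_group_add set" and \<mu> +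
  assumes translate: "\<And>X g. X \<subseteq> U \<Longrightarrow> (+) g ` X \<subseteq> U \<Longrightarrow> \<mu> ((+) g ` X) = \<mu> X"

lemma polynomial_growth_has_slow_step:
  fixes a :: "nat \<Rightarrow> real"
  assumes "\<And>n. a n \<le> real (Suc n) ^ k" "a 0 > 0" "\<epsilon> > 0"
  shows "\<exists>n. a (Suc n) \<le> (1 + \<epsilon>) * a n"
proof (rule ccontr)
  assume "\<not> ?thesis"
  then have fast: "(1 + \<epsilon>) * a n < a (Suc n)" for n
    by (simp add: not_le)
  have exponential: "(1 + \<epsilon>) ^ n * a 0 \<le> a n" for n
  proof (induction n)
    case (Suc n)
    then have "(1 + \<epsilon>) * ((1 + \<epsilon>) ^ n * a 0) \<le> (1 + \<epsilon>) * a n"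
      using \<open>\<epsilon> > 0\<close> by (intro mult_left_mono) auto
    then show ?case using fast[of n] by (simp add: mult.assoc)
  qed simp
  have "(\<lambda>n. real (Suc n) ^ k / (1 + \<epsilon>) ^ n) \<longlonglongrightarrow> 0"
    using \<open>\<epsilon> > 0\<close> by real_asymp
  then have "eventually (\<lambda>n. real (Suc n) ^ k / (1 + \<epsilon>) ^ n < a 0) sequentially"
    by (rule order_tendstoD) fact
  then obtain n where "real (Suc n) ^ k / (1 + \<epsilon>) ^ n < a 0"
    by (auto simp: eventually_sequentially)
  then have "real (Suc n) ^ k < (1 + \<epsilon>) ^ n * a 0"
    using \<open>\<epsilon> > 0\<close> by (simp add: pos_divide_less_eq mult.commute del: of_nat_Suc)
  also have "\<dots> \<le> real (Suc n) ^ k"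
    using exponential assms(1) by (rule order_trans)
  finally show False by simp
qed

definition box_sums :: "'a::comm_monoid_add set \<Rightarrow> nat \<Rightarrow> 'a set" where
  "box_sums P n = (\<lambda>c. \<Sum>p\<in>P. \<Sum>i<c p. p) ` (P \<rightarrow>\<^sub>E {..n})"

lemma finite_box_sums: "finite P \<Longrightarrow> finite (box_sums P n)"
  unfolding box_sums_def by (intro finite_imageI finite_PiE) auto

lemma card_box_sums_le:
  assumes "finite P"
  shows "card (box_sums P n) \<le> Suc n ^ card P"
proof -
  have "card (box_sums P n) \<le> card (P \<rightarrow>\<^sub>E {..n})"
    unfolding box_sums_def using assms by (intro card_image_le finite_PiE) auto
  also have "\<dots> = Suc n ^ card P"
    using assms by (simp add: card_PiE)
  finally show ?thesis .
qed

lemma box_sums_Suc_mono: "box_sums P n \<subseteq> box_sums P (Suc n)"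
  unfolding box_sums_def by (intro image_mono PiE_mono) auto

lemma zero_in_box_sums: "0 \<in> box_sums P n"
  unfolding box_sums_def by (rule image_eqI[of _ _ "\<lambda>x\<in>P. 0"]) auto

lemma translate_box_sums_subset:
  assumes "finite P" "p \<in> P"
  shows "(+) p ` box_sums P n \<subseteq> box_sums P (Suc n)"
proof clarify
  fix x assume "x \<in> box_sums P n"
  then obtain c where c: "c \<in> P \<rightarrow>\<^sub>E {..n}" "x = (\<Sum>q\<in>P. \<Sum>i<c q. q)"
    by (auto simp: box_sums_def)
  define c' where "c' = c(p := Suc (c p))"
  have "c' \<in> P \<rightarrow>\<^sub>E {..Suc n}"
    using c(1) assms(2) by (auto simp: c'_def PiE_iff extensional_def le_SucI)
  moreover have "p + x = (\<Sum>q\<in>P. \<Sum>i<c' q. q)"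
    using assms c(2) by (simp add: sum.remove[of P p] c'_def ac_simps cong: sum.cong_simp)
  ultimately show "p + x \<in> box_sums P (Suc n)"
    unfolding box_sums_def by (intro image_eqI)
qed

lemma folner_set_exists:
  fixes U E :: "'a::ab_group_add set" and \<epsilon> :: real
  assumes "0 \<in> U" "finite E" "\<epsilon> > 0"
  shows "\<exists>Q. finite Q \<and> U \<inter> Q \<noteq> {} \<and>
    (\<forall>e\<in>E. real (card (U \<inter> ((+) e ` Q - Q))) \<le> \<epsilon> * real (card (U \<inter> Q)))"
proof -
  define a where "a n = card (U \<inter> box_sums E n)" for n
  note finite_boxes [simp] = finite_box_sums[OF assms(2)]
  have "real (a n) \<le> real (Suc n) ^ card E" for n
  proof -
    have "a n \<le> card (box_sums E n)" unfolding a_def by (intro card_mono) auto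
    also have "\<dots> \<le> Suc n ^ card E" by (rule card_box_sums_le) fact
    finally show ?thesis by (metis of_nat_le_iff of_nat_power)
  qed
  moreover have "real (a 0) > 0"
    using zero_in_box_sums[of E 0] assms(1) by (auto simp: a_def card_gt_0_iff)
  ultimately obtain n where n: "real (a (Suc n)) \<le> (1 + \<epsilon>) * real (a n)"
    using polynomial_growth_has_slow_step[of "\<lambda>n. real (a n)"] \<open>\<epsilon> > 0\<close> by blast
  let ?Q = "box_sums E n"
  show ?thesis
  proof (intro exI conjI ballI)
    show "finite ?Q" by simp
    show "U \<inter> ?Q \<noteq> {}" using zero_in_box_sums \<open>0 \<in> U\<close> by blast
    fix e assume "e \<in> E"
    have "card (U \<inter> ((+) e ` ?Q - ?Q)) \<le> card (U \<inter> box_sums E (Suc n) - U \<inter> ?Q)"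
      using translate_box_sums_subset[OF assms(2) \<open>e \<in> E\<close>, of n] by (intro card_mono) auto
    also have "real \<dots> = real (a (Suc n)) - real (a n)"
      unfolding a_def using box_sums_Suc_mono[of E n]
      by (subst card_Diff_subset) (auto intro!: of_nat_diff card_mono)
    also have "\<dots> \<le> \<epsilon> * real (a n)"
      using n by (simp add: algebra_simps)
    finally show "real (card (U \<inter> ((+) e ` ?Q - ?Q))) \<le> \<epsilon> * real (card (U \<inter> ?Q))"
      by (simp add: a_def)
  qed
qed

definition counting_content :: "'a set \<Rightarrow> 'a set \<Rightarrow> 'a set \<Rightarrow> real" where
  "counting_content U Q X = real (card (X \<inter> U \<inter> Q)) / real (card (U \<inter> Q))"

lemma counting_content_nonneg: "0 \<le> counting_content U Q X"
  by (simp add: counting_content_def)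

lemma counting_content_le_1:
  assumes "finite Q"
  shows "counting_content U Q X \<le> 1"
proof -
  have "card (X \<inter> U \<inter> Q) \<le> card (U \<inter> Q)" using assms by (intro card_mono) auto
  then show ?thesis unfolding counting_content_def by (intro divide_le_eq_1[THEN iffD2]) linarith
qed

lemma probability_content_counting:
  assumes "finite Q" "U \<inter> Q \<noteq> {}"
  shows "probability_content U (counting_content U Q)"
proof
  show "counting_content U Q U = 1"
    using assms by (simp add: counting_content_def)
  fix X Y :: "'a set" assume "X \<inter> Y = {}"
  then have "card ((X \<inter> U \<inter> Q) \<union> (Y \<inter> U \<inter> Q)) = card (X \<inter> U \<inter> Q) + card (Y \<inter> U \<inter> Q)"
    using assms by (intro card_Un_disjoint) auto
  then show "counting_content U Q (X \<union> Y) = counting_content U Q X + counting_content U Q Y"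
    by (simp add: counting_content_def Int_Un_distrib2 add_divide_distrib)
qed (rule counting_content_nonneg)

lemma counting_content_translate_le:
  fixes U Q X :: "'a::ab_group_add set"
  assumes "finite Q" "U \<inter> Q \<noteq> {}" "X \<subseteq> U"
    and boundary: "real (card (U \<inter> ((+) (- g) ` Q - Q))) \<le> \<epsilon> * real (card (U \<inter> Q))"
  shows "counting_content U Q ((+) g ` X) \<le> counting_content U Q X + \<epsilon>"
proof -
  let ?R = "U \<inter> ((+) (- g) ` Q - Q)"
  have "(+) g ` X \<inter> U \<inter> Q \<subseteq> (+) g ` (X \<inter> U \<inter> Q \<union> ?R)"
  proof clarify
    fix x assume "x \<in> X" "g + x \<in> Q"
    moreover have "x = - g + (g + x)" by simp
    ultimately show "g + x \<in> (+) g ` (X \<inter> U \<inter> Q \<union> ?R)"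
      using \<open>X \<subseteq> U\<close> by blast
  qed
  then have "card ((+) g ` X \<inter> U \<inter> Q) \<le> card (X \<inter> U \<inter> Q \<union> ?R)"
    using \<open>finite Q\<close> by (intro surj_card_le) auto
  also have "\<dots> \<le> card (X \<inter> U \<inter> Q) + card ?R"
    by (rule card_Un_le)
  finally have "real (card ((+) g ` X \<inter> U \<inter> Q)) \<le> real (card (X \<inter> U \<inter> Q)) + \<epsilon> * real (card (U \<inter> Q))"
    using boundary by linarith
  moreover have "real (card (U \<inter> Q)) > 0"
    using assms(1,2) by (simp add: card_gt_0_iff)
  ultimately show ?thesis
    by (simp add: counting_content_def pos_divide_le_eq distrib_right)
qed

definition almost_invariant_contents ::
  "'a::ab_group_add set \<Rightarrow> 'a \<Rightarrow> real \<Rightarrow> ('a set \<Rightarrow> real) set" where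
  "almost_invariant_contents U g \<epsilon> =
     {\<mu>. probability_content U \<mu> \<and>
       (\<forall>X. X \<subseteq> U \<longrightarrow> (+) g ` X \<subseteq> U \<longrightarrow> \<mu> ((+) g ` X) \<le> \<mu> X + \<epsilon>)}"

lemma closed_almost_invariant_contents: "closed (almost_invariant_contents U g \<epsilon>)"
proof -
  have "almost_invariant_contents U g \<epsilon> = (\<Inter>X. {\<mu>. 0 \<le> \<mu> X}) \<inter> {\<mu>. \<mu> U = 1} \<inter>
      (\<Inter>X\<in>Pow U. \<Inter>Y\<in>{Y. Y \<subseteq> U \<and> X \<inter> Y = {}}. {\<mu>. \<mu> (X \<union> Y) = \<mu> X + \<mu> Y}) \<inter>
      (\<Inter>X\<in>{X. X \<subseteq> U \<and> (+) g ` X \<subseteq> U}. {\<mu>. \<mu> ((+) g ` X) \<le> \<mu> X + \<epsilon>})"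
    by (auto simp: almost_invariant_contents_def probability_content_def)
  also have "closed \<dots>"
    by (intro closed_Int closed_INT ballI closed_Collect_eq closed_Collect_le
        continuous_intros continuous_on_product_coordinates)
  finally show ?thesis .
qed

lemma almost_invariant_content_exists:
  fixes U :: "'a::ab_group_add set"
  assumes "0 \<in> U" "finite I" "I \<subseteq> UNIV \<times> {0<..}"
  shows "\<exists>\<mu>. range \<mu> \<subseteq> {0..1} \<and> (\<forall>(g, \<epsilon>)\<in>I. \<mu> \<in> almost_invariant_contents U g \<epsilon>)"
proof -
  define \<delta> where "\<delta> = Min (insert 1 (snd ` I))"
  have "\<delta> > 0" using assms(2,3) by (auto simp: \<delta>_def)
  have \<delta>_le: "\<delta> \<le> \<epsilon>" if "(g, \<epsilon>) \<in> I" for g \<epsilon>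
    unfolding \<delta>_def using assms(2) imageI[OF that, of snd] by (intro Min_le) auto
  obtain Q where Q: "finite Q" "U \<inter> Q \<noteq> {}"
    and boundary: "\<forall>e\<in>(uminus \<circ> fst) ` I.
      real (card (U \<inter> ((+) e ` Q - Q))) \<le> \<delta> * real (card (U \<inter> Q))"
    using folner_set_exists[OF assms(1) finite_imageI[OF assms(2), of "uminus \<circ> fst"] \<open>\<delta> > 0\<close>]
    by blast
  have "counting_content U Q \<in> almost_invariant_contents U g \<epsilon>" if "(g, \<epsilon>) \<in> I" for g \<epsilon>
  proof -
    have "- g \<in> (uminus \<circ> fst) ` I"
      using imageI[OF that, of "uminus \<circ> fst"] by simp
    have "counting_content U Q ((+) g ` X) \<le> counting_content U Q X + \<epsilon>" if "X \<subseteq> U" for X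
    proof -
      have "counting_content U Q ((+) g ` X) \<le> counting_content U Q X + \<delta>"
        by (intro counting_content_translate_le Q that bspec[OF boundary]) fact
      then show ?thesis using \<delta>_le[OF \<open>(g, \<epsilon>) \<in> I\<close>] by linarith
    qed
    then show ?thesis
      using probability_content_counting[OF Q] by (simp add: almost_invariant_contents_def)
  qed
  moreover have "range (counting_content U Q) \<subseteq> {0..1}"
    by (simp add: image_subset_iff counting_content_nonneg counting_content_le_1[OF Q(1)])
  ultimately show ?thesis
    by (intro exI[of _ "counting_content U Q"] conjI ballI) auto
qed

lemma translation_invariant_contentI:
  assumes "\<And>g \<epsilon>. \<epsilon> > 0 \<Longrightarrow> \<mu> \<in> almost_invariant_contents U g \<epsilon>"
  shows "translation_invariant_content U \<mu>"
proof -
  interpret probability_content U \<mu>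
    using assms[of 1 0] by (simp add: almost_invariant_contents_def)
  have translate_le: "\<mu> ((+) g ` X) \<le> \<mu> X" if "X \<subseteq> U" "(+) g ` X \<subseteq> U" for X g
  proof (rule field_le_epsilon)
    fix \<epsilon> :: real assume "\<epsilon> > 0"
    from assms[OF this, of g] show "\<mu> ((+) g ` X) \<le> \<mu> X + \<epsilon>"
      using that by (simp add: almost_invariant_contents_def)
  qed
  show ?thesis
  proof
    fix X g assume X: "X \<subseteq> U" "(+) g ` X \<subseteq> U"
    have "(+) (- g) ` (+) g ` X = X" by (simp add: image_image)
    then show "\<mu> ((+) g ` X) = \<mu> X"
      using translate_le[OF X] translate_le[of "(+) g ` X" "- g"] X by simp
  qed
qed

lemma translation_invariant_content_exists:
  fixes U :: "'a::ab_group_add set"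
  assumes "0 \<in> U"
  shows "\<exists>\<mu>. translation_invariant_content U \<mu>"
proof -
  define unit_box :: "('a set \<Rightarrow> real) set" where "unit_box = UNIV \<rightarrow>\<^sub>E {0..1}"
  let ?C = "\<lambda>(g, \<epsilon>). almost_invariant_contents U g \<epsilon>" and ?I = "UNIV \<times> {0<..}"
  have "compactin (product_topology (\<lambda>_. euclidean) UNIV) unit_box"
    unfolding unit_box_def compactin_PiE by simp
  then have "compact unit_box"
    by (simp add: euclidean_product_topology)
  then have "unit_box \<inter> \<Inter>(?C ` ?I) \<noteq> {}"
  proof (rule compact_imp_fip)
    show "closed T" if "T \<in> ?C ` ?I" for T
      using that closed_almost_invariant_contents by auto
    fix \<F> assume "finite \<F>" "\<F> \<subseteq> ?C ` ?I"
    then obtain I where I: "finite I" "I \<subseteq> ?I" "\<F> = ?C ` I"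
      by (meson finite_subset_image)
    obtain \<mu> where "range \<mu> \<subseteq> {0..1}" "\<forall>(g, \<epsilon>)\<in>I. \<mu> \<in> almost_invariant_contents U g \<epsilon>"
      using almost_invariant_content_exists[OF assms I(1,2)] by blast
    then have "\<mu> \<in> unit_box \<inter> \<Inter>\<F>"
      unfolding I(3) unit_box_def by (auto simp: image_subset_iff)
    then show "unit_box \<inter> \<Inter>\<F> \<noteq> {}" by blast
  qed
  then obtain \<mu> where "\<And>g \<epsilon>. \<epsilon> > 0 \<Longrightarrow> \<mu> \<in> almost_invariant_contents U g \<epsilon>" by auto
  then show ?thesis using translation_invariant_contentI by blast
qed

section \<open>The theorem of Massicot and Wagner for abelian groups\<close>

context translation_invariant_content
begin

lemma content_pos_of_covering:
  assumes "A \<subseteq> U" "covered_by_translates U A"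
  shows "\<mu> A > 0"
proof -
  obtain F where F: "finite F" "U \<subseteq> A + F"
    using assms(2) by (auto simp: covered_by_translates_def)
  have translate_le: "\<mu> (U \<inter> (+) f ` A) \<le> \<mu> A" for f
  proof -
    have as_translate: "U \<inter> (+) f ` A = (+) f ` (A \<inter> (+) (- f) ` U)"
      by (simp add: image_Int image_image Int_commute)
    have "\<mu> (U \<inter> (+) f ` A) = \<mu> (A \<inter> (+) (- f) ` U)"
      using assms(1) unfolding as_translate by (intro translate) (auto simp flip: as_translate)
    also have "\<dots> \<le> \<mu> A" using assms(1) by (intro subset_le) auto
    finally show ?thesis .
  qed
  have "U = (\<Union>f\<in>F. U \<inter> (+) f ` A)"
    using F(2) by (force simp: add.commute elim!: set_plus_elim)
  then have "1 = \<mu> (\<Union>f\<in>F. U \<inter> (+) f ` A)"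
    using full by simp
  also have "\<dots> \<le> (\<Sum>f\<in>F. \<mu> (U \<inter> (+) f ` A))"
    using F(1) by (intro UN_le) auto
  also have "\<dots> \<le> real (card F) * \<mu> A"
    using translate_le by (intro sum_bounded_above)
  finally show ?thesis
    using nonneg[of A] by (cases "\<mu> A = 0") auto
qed

definition overlap_set :: "'a set \<Rightarrow> real \<Rightarrow> 'a set" where
  "overlap_set B t = {g. t \<le> \<mu> ((+) g ` B \<inter> B)}"

lemma content_Int_translates:
  assumes "B \<subseteq> U" "(+) h ` B \<subseteq> U"
  shows "\<mu> ((+) g ` B \<inter> (+) h ` B) = \<mu> ((+) (g - h) ` B \<inter> B)"
proof -
  have as_translate: "(+) g ` B \<inter> (+) h ` B = (+) h ` ((+) (g - h) ` B \<inter> B)"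
    by (simp add: image_Int image_image)
  show ?thesis
    using assms unfolding as_translate by (intro translate) (auto simp flip: as_translate)
qed

lemma zero_in_overlap_set:
  assumes "B \<subseteq> U"
  shows "0 \<in> overlap_set B ((\<mu> B)\<^sup>2 / 4)"
proof -
  have "(\<mu> B)\<^sup>2 \<le> \<mu> B"
    using le_1[OF assms] nonneg by (simp add: power2_eq_square mult_left_le)
  then show ?thesis
    using nonneg[of B] by (simp add: overlap_set_def)
qed

lemma uminus_in_overlap_set:
  assumes "B \<subseteq> U" "g \<in> overlap_set B t"
  shows "- g \<in> overlap_set B t"
proof -
  have as_translate: "(+) (- g) ` B \<inter> B = (+) (- g) ` ((+) g ` B \<inter> B)"
    by (simp add: image_Int image_image Int_commute)
  have "\<mu> ((+) (- g) ` B \<inter> B) = \<mu> ((+) g ` B \<inter> B)"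
    using assms(1) unfolding as_translate by (intro translate) (auto simp flip: as_translate)
  then show ?thesis using assms(2) by (simp add: overlap_set_def)
qed

lemma overlap_set_subset_difference_set:
  assumes "t > 0"
  shows "overlap_set B t \<subseteq> difference_set B"
proof
  fix g assume "g \<in> overlap_set B t"
  then have "(+) g ` B \<inter> B \<noteq> {}"
    using assms empty_set by (auto simp: overlap_set_def)
  then obtain x y where "x \<in> B" "y \<in> B" "x = g + y" by blast
  then show "g \<in> difference_set B"
    using difference_setI[of x B y] by simp
qed

lemma card_separated_translations_le:
  assumes "B \<subseteq> U" "\<mu> B > 0" "finite Y" and translates: "\<And>y. y \<in> Y \<Longrightarrow> (+) y ` B \<subseteq> U"
    and separated: "pairwise (\<lambda>x y. x - y \<notin> overlap_set B ((\<mu> B)\<^sup>2 / 4)) Y"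
  shows "real (card Y) \<le> 2 / \<mu> B"
proof (rule ccontr)
  define b where "b = \<mu> B"
  have b: "0 < b" "b \<le> 1"
    using assms(1,2) le_1 by (auto simp: b_def)
  assume "\<not> real (card Y) \<le> 2 / \<mu> B"
  then have "nat \<lceil>2 / b\<rceil> \<le> card Y" unfolding b_def by linarith
  then obtain Z where Z: "Z \<subseteq> Y" "card Z = nat \<lceil>2 / b\<rceil>" "finite Z"
    by (rule obtain_subset_with_card_n)
  define n where "n = real (card Z)"
  have "2 / b \<le> n" "n \<le> 2 / b + 1"
    using Z(2) b divide_pos_pos[of 2 b] unfolding n_def by linarith+
  then have nb: "2 \<le> n * b" "n * b \<le> 3"
    using b by (simp_all add: field_simps)
  have "n * b - n\<^sup>2 / 2 * (b\<^sup>2 / 4) \<le> \<mu> (\<Union>y\<in>Z. (+) y ` B)"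
    unfolding n_def
  proof (rule UN_ge)
    show translate_subset: "(+) y ` B \<subseteq> U" if "y \<in> Z" for y using translates that Z(1) by blast
    show "\<mu> ((+) y ` B) = b" if "y \<in> Z" for y
      unfolding b_def by (rule translate[OF assms(1) translate_subset[OF that]])
    show "\<mu> ((+) x ` B \<inter> (+) y ` B) \<le> b\<^sup>2 / 4" if "x \<in> Z" "y \<in> Z" "x \<noteq> y" for x y
    proof -
      have "x - y \<notin> overlap_set B (b\<^sup>2 / 4)"
        using pairwiseD[OF separated, of x y] that Z(1) by (auto simp: b_def)
      then show ?thesis
        using content_Int_translates[OF assms(1) translate_subset[OF that(2)]]
        by (simp add: overlap_set_def)
    qed
  qed (use Z in auto)
  also have "\<dots> \<le> 1"
    using translates Z(1) by (intro le_1) blast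
  finally have "n * b - (n * b)\<^sup>2 / 8 \<le> 1"
    by (simp add: power_mult_distrib)
  moreover have "0 \<le> (n * b - 2) * (3 - n * b)" using nb by simp
  ultimately show False using nb by (simp add: algebra_simps power2_eq_square)
qed

lemma covered_by_overlap_set:
  assumes "B \<subseteq> U" "\<mu> B > 0" "A + B \<subseteq> U"
  shows "covered_by_translates A (overlap_set B ((\<mu> B)\<^sup>2 / 4))"
proof (rule covered_by_translates_of_separated_bound)
  show "0 \<in> overlap_set B ((\<mu> B)\<^sup>2 / 4)"
    using assms(1) by (rule zero_in_overlap_set)
  show "- g \<in> overlap_set B ((\<mu> B)\<^sup>2 / 4)" if "g \<in> overlap_set B ((\<mu> B)\<^sup>2 / 4)" for g
    using assms(1) that by (rule uminus_in_overlap_set)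
  fix Y assume Y: "Y \<subseteq> A" "finite Y"
    "pairwise (\<lambda>x y. x - y \<notin> overlap_set B ((\<mu> B)\<^sup>2 / 4)) Y"
  have "(+) y ` B \<subseteq> U" if "y \<in> Y" for y
    using that Y(1) assms(3) by blast
  then show "real (card Y) \<le> 2 / \<mu> B"
    using card_separated_translations_le assms Y by blast
qed

text \<open>The content of \<open>B + A\<close> cannot drop by \<open>\<delta>\<close> more than \<open>1 / \<delta>\<close> times.\<close>

lemma stable_summand_exists:
  assumes "A \<subseteq> U" "A + A \<subseteq> U" "\<mu> A > 0" "\<delta> > 0"
  shows "\<exists>B\<subseteq>A. \<mu> B > 0 \<and>
    (\<forall>B'\<subseteq>B. (\<mu> B)\<^sup>2 / 4 \<le> \<mu> B' \<longrightarrow> \<mu> (B + A) - \<delta> \<le> \<mu> (B' + A))"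
proof (rule ccontr)
  assume "\<not> ?thesis"
  then have unstable: "\<exists>B'\<subseteq>B. (\<mu> B)\<^sup>2 / 4 \<le> \<mu> B' \<and> \<mu> (B' + A) < \<mu> (B + A) - \<delta>"
    if "B \<subseteq> A" "\<mu> B > 0" for B
    using that by (meson not_less)
  have drop: "\<exists>B\<subseteq>A. \<mu> B > 0 \<and> \<mu> (B + A) \<le> 1 - real n * \<delta>" for n
  proof (induction n)
    case 0
    show ?case using assms(3) le_1[OF assms(2)] by auto
  next
    case (Suc n)
    then obtain B where B: "B \<subseteq> A" "\<mu> B > 0" "\<mu> (B + A) \<le> 1 - real n * \<delta>" by blast
    then obtain B' where B': "B' \<subseteq> B" "(\<mu> B)\<^sup>2 / 4 \<le> \<mu> B'" "\<mu> (B' + A) < \<mu> (B + A) - \<delta>"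
      using unstable by blast
    have "0 < (\<mu> B)\<^sup>2 / 4" using B(2) by simp
    then have "0 < \<mu> B'" using B'(2) by linarith
    then show ?case
      using B B' by (intro exI[of _ B']) (auto simp: algebra_simps)
  qed
  obtain n where "real n * \<delta> > 1"
    using \<open>\<delta> > 0\<close> reals_Archimedean3 by blast
  then show False
    using drop[of n] nonneg by (smt (verit))
qed

lemma content_escape_le_of_stable:
  assumes "B + A \<subseteq> U" "g \<in> overlap_set B t"
    and stable: "\<And>B'. B' \<subseteq> B \<Longrightarrow> t \<le> \<mu> B' \<Longrightarrow> \<mu> (B + A) - \<delta> \<le> \<mu> (B' + A)"
  shows "\<mu> ((B + A) - (+) g ` (B + A)) \<le> \<delta>"
proof -
  let ?B' = "(+) g ` B \<inter> B"
  have "?B' + A \<subseteq> (B + A) \<inter> (+) g ` (B + A)"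
  proof
    fix x assume "x \<in> ?B' + A"
    then obtain b a where "b \<in> B" "g + b \<in> B" "a \<in> A" "x = g + b + a"
      by (auto elim!: set_plus_elim)
    then have "x \<in> B + A" "b + a \<in> B + A" "x = g + (b + a)"
      using set_plus_intro[of "g + b" B a A] by (auto simp: add.assoc)
    then show "x \<in> (B + A) \<inter> (+) g ` (B + A)" by blast
  qed
  then have "\<mu> (?B' + A) \<le> \<mu> ((B + A) \<inter> (+) g ` (B + A))"
    using assms(1) by (intro subset_le) auto
  moreover have "\<mu> (B + A) - \<delta> \<le> \<mu> (?B' + A)"
    using assms(2) by (intro stable) (auto simp: overlap_set_def)
  ultimately show ?thesis
    using Diff[OF assms(1)] by simp
qed

lemma content_escape_add_le:
  assumes "D \<subseteq> U" "(+) g ` D \<subseteq> U"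
  shows "\<mu> (D - (+) (h + g) ` D) \<le> \<mu> (D - (+) h ` D) + \<mu> (D - (+) g ` D)"
proof -
  let ?R = "D - (+) h ` D"
  have R: "(+) g ` ?R \<subseteq> U" using assms(2) by blast
  have "D - (+) (h + g) ` D \<subseteq> (+) g ` ?R \<union> (D - (+) g ` D)"
    by (auto simp: image_iff ac_simps)
  then have "\<mu> (D - (+) (h + g) ` D) \<le> \<mu> ((+) g ` ?R \<union> (D - (+) g ` D))"
    using assms(1) R by (intro subset_le) auto
  also have "\<dots> \<le> \<mu> ((+) g ` ?R) + \<mu> (D - (+) g ` D)"
    using assms(1) R by (intro Un_le) auto
  also have "\<mu> ((+) g ` ?R) = \<mu> ?R"
    using assms(1) R by (intro translate) auto
  finally show ?thesis .
qed

lemma content_escape_iterated_sumset_le: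
  assumes "D \<subseteq> U" "\<And>g. g \<in> S \<Longrightarrow> (+) g ` D \<subseteq> U" "\<And>g. g \<in> S \<Longrightarrow> \<mu> (D - (+) g ` D) \<le> \<delta>"
  shows "s \<in> iterated_sumset n S \<Longrightarrow> \<mu> (D - (+) s ` D) \<le> real n * \<delta>"
proof (induction n arbitrary: s)
  case 0
  then show ?case by (simp add: empty_set)
next
  case (Suc n)
  then obtain h g where "h \<in> iterated_sumset n S" "g \<in> S" "s = h + g"
    by (auto elim: set_plus_elim)
  then show ?case
    using content_escape_add_le[of D g h] Suc.IH[of h] assms by (fastforce simp: algebra_simps)
qed

lemma content_le_sumset:
  assumes "B \<noteq> {}" "A \<subseteq> U" "B + A \<subseteq> U"
  shows "\<mu> A \<le> \<mu> (B + A)"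
proof -
  obtain b where "b \<in> B" using assms(1) by blast
  then have "(+) b ` A \<subseteq> B + A" by blast
  moreover from this have "\<mu> ((+) b ` A) = \<mu> A"
    using assms(2,3) by (intro translate) auto
  ultimately show ?thesis
    using subset_le assms(3) by metis
qed

lemma iterated_sumset_subset_difference_set:
  assumes "D \<subseteq> U" "\<And>g. g \<in> S \<Longrightarrow> (+) g ` D \<subseteq> U" "\<And>g. g \<in> S \<Longrightarrow> \<mu> (D - (+) g ` D) \<le> \<delta>"
    and "real n * \<delta> < \<mu> D"
  shows "iterated_sumset n S \<subseteq> difference_set D"
proof
  fix s assume "s \<in> iterated_sumset n S"
  then have "\<mu> (D - (+) s ` D) < \<mu> D"
    using content_escape_iterated_sumset_le[OF assms(1-3)] assms(4) by fastforce
  then have "D \<inter> (+) s ` D \<noteq> {}" by (metis Diff_triv less_irrefl)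
  then obtain x y where "x \<in> D" "y \<in> D" "x = s + y" by blast
  then show "s \<in> difference_set D"
    using difference_setI[of x D y] by simp
qed

lemma iterated_overlap_set_subset_difference_set:
  assumes "B \<noteq> {}" "A \<subseteq> U" "B + A \<subseteq> U"
    and translates: "\<And>g. g \<in> overlap_set B t \<Longrightarrow> (+) g ` (B + A) \<subseteq> U"
    and stable: "\<And>B'. B' \<subseteq> B \<Longrightarrow> t \<le> \<mu> B' \<Longrightarrow> \<mu> (B + A) - \<delta> \<le> \<mu> (B' + A)"
    and "real n * \<delta> < \<mu> A"
  shows "iterated_sumset n (overlap_set B t) \<subseteq> difference_set (B + A)"
proof (rule iterated_sumset_subset_difference_set)
  show "\<mu> ((B + A) - (+) g ` (B + A)) \<le> \<delta>" if "g \<in> overlap_set B t" for g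
    using assms(3) that stable by (rule content_escape_le_of_stable)
  show "real n * \<delta> < \<mu> (B + A)"
    using content_le_sumset[OF assms(1-3)] assms(6) by simp
qed (rule assms(3) translates; assumption)+

lemma stable_overlap_set_exists:
  assumes "A \<subseteq> U" "A + A \<subseteq> U" "difference_set A + (A + A) \<subseteq> U" "\<mu> A > 0" "n > 0"
  shows "\<exists>B\<subseteq>A. \<mu> B > 0 \<and>
    iterated_sumset n (overlap_set B ((\<mu> B)\<^sup>2 / 4)) \<subseteq> difference_set (A + A)"
proof -
  define \<delta> where "\<delta> = \<mu> A / (2 * real n)"
  have "\<delta> > 0" "real n * \<delta> < \<mu> A"
    using \<open>\<mu> A > 0\<close> \<open>n > 0\<close> by (simp_all add: \<delta>_def)
  obtain B where B: "B \<subseteq> A" "\<mu> B > 0"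
    and stable: "\<And>B'. B' \<subseteq> B \<Longrightarrow> (\<mu> B)\<^sup>2 / 4 \<le> \<mu> B' \<Longrightarrow> \<mu> (B + A) - \<delta> \<le> \<mu> (B' + A)"
    using stable_summand_exists[OF assms(1,2,4) \<open>\<delta> > 0\<close>] by blast
  let ?S = "overlap_set B ((\<mu> B)\<^sup>2 / 4)"
  have "B \<noteq> {}" using B(2) empty_set by auto
  have BA: "B + A \<subseteq> A + A" using B(1) by (intro set_plus_mono2) simp_all
  have "?S \<subseteq> difference_set A"
    using overlap_set_subset_difference_set[of "(\<mu> B)\<^sup>2 / 4" B] B difference_set_mono[OF B(1)]
    by simp
  then have translates: "(+) g ` (B + A) \<subseteq> U" if "g \<in> ?S" for g
    using that BA assms(3) by blast
  have "iterated_sumset n ?S \<subseteq> difference_set (B + A)"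
    using \<open>B \<noteq> {}\<close> assms(1) order_trans[OF BA assms(2)] translates stable \<open>real n * \<delta> < \<mu> A\<close>
    by (rule iterated_overlap_set_subset_difference_set)
  also have "\<dots> \<subseteq> difference_set (A + A)"
    by (rule difference_set_mono) (rule BA)
  finally show ?thesis using B by blast
qed

end

text \<open>\<open>S\<close> consists of the translations moving a stable \<open>B\<close> to a set that overlaps \<open>B\<close>
  substantially: each of them almost preserves \<open>B + A\<close>, so a sum of \<open>n\<close> of them cannot move
  \<open>B + A\<close> off itself.\<close>

theorem massicot_wagner:
  fixes A :: "'a::ab_group_add set"
  assumes A: "approximate_subgroup A" and "n > 0"
  shows "\<exists>S. approximate_subgroup S \<and> covered_by_translates A S \<and>
    iterated_sumset n S \<subseteq> iterated_sumset 4 A"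
proof -
  let ?U = "iterated_sumset 4 A"
  note zero = approximate_subgroup_zero[OF A] and symmetric = approximate_subgroup_uminus[OF A]
  have U: "A \<subseteq> ?U" "A + A \<subseteq> ?U"
    using iterated_sumset_le_subset[OF zero, of 1 4] iterated_sumset_le_subset[OF zero, of 2 4]
    by (simp_all add: eval_nat_numeral)
  have difference: "difference_set A = A + A" "difference_set (A + A) = ?U" "(A + A) + (A + A) = ?U"
    using difference_set_symmetric[of A] difference_set_sumset_symmetric[of A] symmetric
    by (simp_all add: eval_nat_numeral add.assoc)
  obtain \<mu> where "translation_invariant_content ?U \<mu>"
    using translation_invariant_content_exists zero_in_iterated_sumset[OF zero] by blast
  then interpret translation_invariant_content ?U \<mu> .
  have "\<mu> A > 0"
    using U(1) iterated_sumset_covered[OF A] by (rule content_pos_of_covering)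
  then obtain B where B: "B \<subseteq> A" "\<mu> B > 0"
    and root: "iterated_sumset n (overlap_set B ((\<mu> B)\<^sup>2 / 4)) \<subseteq> ?U"
    using stable_overlap_set_exists[OF U _ _ \<open>n > 0\<close>] unfolding difference by blast
  define S where "S = overlap_set B ((\<mu> B)\<^sup>2 / 4)"
  have "S \<subseteq> A + A"
    using overlap_set_subset_difference_set[of "(\<mu> B)\<^sup>2 / 4" B] B(2) difference_set_mono[OF B(1)]
    by (simp add: S_def difference(1))
  have cover: "covered_by_translates A S"
    unfolding S_def using B U set_plus_mono2[OF order_refl B(1), of A]
    by (intro covered_by_overlap_set) auto
  with A have "approximate_subgroup S"
  proof (rule approximate_subgroup_of_covering)
    show "0 \<in> S" "\<And>g. g \<in> S \<Longrightarrow> - g \<in> S"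
      unfolding S_def using B(1) U(1) zero_in_overlap_set uminus_in_overlap_set by blast+
    show "S + S \<subseteq> ?U"
      using set_plus_mono2[OF \<open>S \<subseteq> A + A\<close> \<open>S \<subseteq> A + A\<close>] by (simp only: difference(3))
  qed
  then show ?thesis using cover root unfolding S_def by blast
qed

section \<open>Seminorms from approximate subgroups\<close>

locale group_seminorm =
  fixes N :: "'a::ab_group_add \<Rightarrow> real"
  assumes zero: "N 0 = 0"
    and nonneg: "\<And>x. 0 \<le> N x"
    and uminus: "\<And>x. N (- x) = N x"
    and add_le: "\<And>x y. N (x + y) \<le> N x + N y"

definition seminorm_totally_bounded :: "('a::ab_group_add \<Rightarrow> real) \<Rightarrow> 'a set \<Rightarrow> bool" where
  "seminorm_totally_bounded N A \<longleftrightarrow> (\<forall>e>0. \<exists>Z. finite Z \<and> (\<forall>a\<in>A. \<exists>z\<in>Z. N (a - z) \<le> e))"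

lemma seminorm_totally_bounded_covered:
  assumes "covered_by_translates A B" "seminorm_totally_bounded N B"
  shows "seminorm_totally_bounded N A"
  unfolding seminorm_totally_bounded_def
proof (intro allI impI)
  fix e :: real assume "e > 0"
  then obtain Z where Z: "finite Z" "\<And>b. b \<in> B \<Longrightarrow> \<exists>z\<in>Z. N (b - z) \<le> e"
    using assms(2) by (auto simp: seminorm_totally_bounded_def)
  obtain F where F: "finite F" "A \<subseteq> B + F"
    using assms(1) by (auto simp: covered_by_translates_def)
  have "\<exists>w\<in>Z + F. N (a - w) \<le> e" if "a \<in> A" for a
  proof -
    obtain b f where "b \<in> B" "f \<in> F" "a = b + f"
      using subsetD[OF F(2) \<open>a \<in> A\<close>] by (rule set_plus_elim)
    moreover obtain z where "z \<in> Z" "N (b - z) \<le> e"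
      using Z(2)[OF \<open>b \<in> B\<close>] by blast
    ultimately show ?thesis
      by (intro bexI[of _ "z + f"]) auto
  qed
  then show "\<exists>Z. finite Z \<and> (\<forall>a\<in>A. \<exists>z\<in>Z. N (a - z) \<le> e)"
    using finite_set_plus[OF Z(1) F(1)] by blast
qed

text \<open>\<open>dyadic_sum V m k\<close> plays the role of the ball of radius \<open>k / 2 ^ m\<close>: the binary
  digits of \<open>k\<close> select which of the sets \<open>V 1, \<dots>, V m\<close> are added up.\<close>

fun dyadic_sum :: "(nat \<Rightarrow> 'a::ab_group_add set) \<Rightarrow> nat \<Rightarrow> nat \<Rightarrow> 'a set" where
  "dyadic_sum V 0 k = (if k = 0 then {0} else UNIV)"
| "dyadic_sum V (Suc m) k = dyadic_sum V m (k div 2) + (if odd k then V (Suc m) else {0})"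

lemma dyadic_sum_0 [simp]: "dyadic_sum V m 0 = {0}"
  by (induction m) auto

lemma dyadic_sum_Suc_1: "dyadic_sum V (Suc m) 1 = V (Suc m)"
  by simp

lemma dyadic_sum_shift: "dyadic_sum V (m + d) (2 ^ d * k) = dyadic_sum V m k"
proof (induction d)
  case (Suc d)
  have "dyadic_sum V (m + Suc d) (2 ^ Suc d * k) = dyadic_sum V (Suc (m + d)) (2 * (2 ^ d * k))"
    by (simp add: mult.assoc)
  also have "\<dots> = dyadic_sum V (m + d) (2 ^ d * k)" by simp
  finally show ?case using Suc.IH by simp
qed simp

locale halving_sequence =
  fixes V :: "nat \<Rightarrow> 'a::ab_group_add set"
  assumes zero: "\<And>n. 0 \<in> V n"
    and symmetric: "\<And>n x. x \<in> V n \<Longrightarrow> - x \<in> V n"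
    and halving: "\<And>n. V (Suc n) + V (Suc n) \<subseteq> V n"
begin

lemma dyadic_sum_add: "dyadic_sum V m j + dyadic_sum V m k \<subseteq> dyadic_sum V m (j + k)"
proof (induction m arbitrary: j k)
  case 0
  show ?case by auto
next
  case (Suc m)
  let ?W = "dyadic_sum V m" and ?digit = "\<lambda>k. if odd k then V (Suc m) else {0}"
  have regroup: "dyadic_sum V (Suc m) j + dyadic_sum V (Suc m) k =
      (?W (j div 2) + ?W (k div 2)) + (?digit j + ?digit k)"
    by (simp add: ac_simps)
  have high_digits: "?W (j div 2) + ?W (k div 2) \<subseteq> ?W (j div 2 + k div 2)" by (rule Suc.IH)
  show ?case
  proof (cases "odd j \<and> odd k")
    case True
    have carry: "V (Suc m) + V (Suc m) \<subseteq> ?W 1"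
    proof (cases m)
      case (Suc m')
      then show ?thesis using halving[of m] by (simp only: dyadic_sum_Suc_1)
    qed simp
    have "dyadic_sum V (Suc m) j + dyadic_sum V (Suc m) k \<subseteq> ?W (j div 2 + k div 2) + ?W 1"
      unfolding regroup using True set_plus_mono2[OF high_digits carry] by simp
    also have "\<dots> \<subseteq> ?W (j div 2 + k div 2 + 1)" by (rule Suc.IH)
    also have "j div 2 + k div 2 + 1 = (j + k) div 2" using True by presburger
    finally show ?thesis using True by simp
  next
    case False
    then have "(j + k) div 2 = j div 2 + k div 2" by presburger
    moreover have "?digit j + ?digit k = ?digit (j + k)"
      using False by auto
    ultimately show ?thesis
      unfolding regroup dyadic_sum.simps(2)[of V m "j + k"]
      using set_plus_mono2[OF high_digits order_refl, of "?digit (j + k)"] by (simp only:)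
  qed
qed

lemma zero_in_dyadic_sum: "0 \<in> dyadic_sum V m k"
proof (induction m arbitrary: k)
  case (Suc m)
  have "0 + 0 \<in> dyadic_sum V m (k div 2) + (if odd k then V (Suc m) else {0})"
    by (intro set_plus_intro Suc.IH) (auto simp: zero)
  then show ?case by simp
qed simp

lemma dyadic_sum_mono:
  assumes "j \<le> k"
  shows "dyadic_sum V m j \<subseteq> dyadic_sum V m k"
proof -
  have "dyadic_sum V m j \<subseteq> dyadic_sum V m (k - j) + dyadic_sum V m j"
    by (intro set_zero_plus2 zero_in_dyadic_sum)
  then show ?thesis using dyadic_sum_add[of m "k - j" j] assms by simp
qed

lemma uminus_in_dyadic_sum: "x \<in> dyadic_sum V m k \<Longrightarrow> - x \<in> dyadic_sum V m k"
proof (induction m arbitrary: k x)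
  case (Suc m)
  let ?digit = "if odd k then V (Suc m) else {0}"
  obtain u v where "u \<in> dyadic_sum V m (k div 2)" "v \<in> ?digit" "x = u + v"
    using Suc.prems by (auto elim!: set_plus_elim)
  then have "- u + - v \<in> dyadic_sum V m (k div 2) + ?digit"
    using Suc.IH symmetric by (intro set_plus_intro) (auto split: if_splits)
  then show ?case using \<open>x = u + v\<close> by simp
qed (auto split: if_splits)

definition dyadic_gauge :: "'a \<Rightarrow> real" where
  "dyadic_gauge x = Inf {real k / 2 ^ m | k m. x \<in> dyadic_sum V m k}"

lemma bdd_below_dyadic_radii: "bdd_below {real k / 2 ^ m | k m. x \<in> dyadic_sum V m k}"
  by (intro bdd_belowI[of _ 0]) auto

lemma dyadic_radii_nonempty: "{real k / 2 ^ m | k m. x \<in> dyadic_sum V m k} \<noteq> {}"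
proof -
  have "x \<in> dyadic_sum V 0 1" by simp
  then show ?thesis by blast
qed

lemma dyadic_gauge_le: "x \<in> dyadic_sum V m k \<Longrightarrow> dyadic_gauge x \<le> real k / 2 ^ m"
  unfolding dyadic_gauge_def by (intro cInf_lower bdd_below_dyadic_radii) auto

lemma dyadic_gauge_lessE:
  assumes "dyadic_gauge x < r"
  obtains k m where "x \<in> dyadic_sum V m k" "real k / 2 ^ m < r"
  using assms cInf_less_iff[OF dyadic_radii_nonempty bdd_below_dyadic_radii]
  unfolding dyadic_gauge_def by blast

lemma dyadic_gauge_add_le: "dyadic_gauge (x + y) \<le> dyadic_gauge x + dyadic_gauge y"
proof (rule field_le_epsilon)
  fix e :: real assume "e > 0"
  obtain j m where j: "x \<in> dyadic_sum V m j" "real j / 2 ^ m < dyadic_gauge x + e / 2"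
    using \<open>e > 0\<close> by (auto intro: dyadic_gauge_lessE[of x "dyadic_gauge x + e / 2"])
  obtain k n where k: "y \<in> dyadic_sum V n k" "real k / 2 ^ n < dyadic_gauge y + e / 2"
    using \<open>e > 0\<close> by (auto intro: dyadic_gauge_lessE[of y "dyadic_gauge y + e / 2"])
  have "x \<in> dyadic_sum V (m + n) (2 ^ n * j)" "y \<in> dyadic_sum V (m + n) (2 ^ m * k)"
    using j(1) k(1) dyadic_sum_shift[of V m n j] dyadic_sum_shift[of V n m k]
    by (simp_all add: add.commute)
  then have "x + y \<in> dyadic_sum V (m + n) (2 ^ n * j + 2 ^ m * k)"
    using dyadic_sum_add by blast
  then have "dyadic_gauge (x + y) \<le> real (2 ^ n * j + 2 ^ m * k) / 2 ^ (m + n)"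
    by (rule dyadic_gauge_le)
  also have "\<dots> = real j / 2 ^ m + real k / 2 ^ n"
    by (simp add: power_add field_simps)
  finally show "dyadic_gauge (x + y) \<le> dyadic_gauge x + dyadic_gauge y + e"
    using j(2) k(2) by linarith
qed

lemma group_seminorm_dyadic_gauge: "group_seminorm dyadic_gauge"
proof
  show nonneg: "0 \<le> dyadic_gauge x" for x
    unfolding dyadic_gauge_def using dyadic_radii_nonempty by (intro cInf_greatest) auto
  show "dyadic_gauge 0 = 0"
    using dyadic_gauge_le[of 0 0 0] nonneg[of 0] by simp
  have "x \<in> dyadic_sum V m k \<longleftrightarrow> - x \<in> dyadic_sum V m k" for x m k
    using uminus_in_dyadic_sum[of x] uminus_in_dyadic_sum[of "- x"] by auto
  then show "dyadic_gauge (- x) = dyadic_gauge x" for x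
    by (simp add: dyadic_gauge_def)
qed (rule dyadic_gauge_add_le)

lemma dyadic_gauge_le_of_mem: "x \<in> V (Suc n) \<Longrightarrow> dyadic_gauge x \<le> 1 / 2 ^ Suc n"
  using dyadic_gauge_le[of x "Suc n" 1] unfolding dyadic_sum_Suc_1 by simp

lemma mem_of_dyadic_gauge_less:
  assumes "dyadic_gauge x < 1 / 2 ^ Suc n"
  shows "x \<in> V (Suc n)"
proof -
  obtain k m where k: "x \<in> dyadic_sum V m k" "real k / 2 ^ m < 1 / 2 ^ Suc n"
    using assms by (rule dyadic_gauge_lessE)
  have "real (2 ^ Suc n * k) \<le> real (2 ^ m)"
    using k(2) by (simp add: field_simps)
  then have "2 ^ Suc n * k \<le> 2 ^ m * 1" by (simp only: of_nat_le_iff mult_1_right)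
  moreover have "x \<in> dyadic_sum V (m + Suc n) (2 ^ Suc n * k)"
    using k(1) by (simp only: dyadic_sum_shift)
  ultimately have "x \<in> dyadic_sum V (Suc n + m) (2 ^ m * 1)"
    using dyadic_sum_mono by (metis add.commute subsetD)
  then show ?thesis by (simp only: dyadic_sum_shift dyadic_sum_Suc_1)
qed

lemma seminorm_totally_bounded_dyadic_gauge:
  assumes "\<And>n. covered_by_translates A (V n)"
  shows "seminorm_totally_bounded dyadic_gauge A"
  unfolding seminorm_totally_bounded_def
proof (intro allI impI)
  fix e :: real assume "e > 0"
  then obtain n where "(1 / 2) ^ n < e"
    using real_arch_pow_inv[of e "1 / 2"] by auto
  moreover have "1 / 2 ^ Suc n \<le> (1 / 2 :: real) ^ n" by (simp add: field_simps)
  ultimately have n: "1 / 2 ^ Suc n \<le> e" by linarith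
  obtain Z where Z: "finite Z" "A \<subseteq> V (Suc n) + Z"
    using assms by (auto simp: covered_by_translates_def)
  have "\<exists>z\<in>Z. dyadic_gauge (a - z) \<le> e" if "a \<in> A" for a
  proof -
    obtain v z where "v \<in> V (Suc n)" "z \<in> Z" "a = v + z"
      using subsetD[OF Z(2) \<open>a \<in> A\<close>] by (rule set_plus_elim)
    then show ?thesis
      using dyadic_gauge_le_of_mem[of v n] n by (intro bexI[of _ z]) auto
  qed
  then show "\<exists>Z. finite Z \<and> (\<forall>a\<in>A. \<exists>z\<in>Z. dyadic_gauge (a - z) \<le> e)"
    using Z(1) by blast
qed

end

lemma approximate_subgroup_chain:
  assumes "approximate_subgroup A"
  obtains S where "S 0 = A" "\<And>n::nat. approximate_subgroup (S n)"
    "\<And>n. covered_by_translates (S n) (S (Suc n))"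
    "\<And>n. iterated_sumset 8 (S (Suc n)) \<subseteq> iterated_sumset 4 (S n)"
proof -
  define refines where "refines X Y \<longleftrightarrow> covered_by_translates X Y \<and>
    iterated_sumset 8 Y \<subseteq> iterated_sumset 4 X" for X Y :: "'a set"
  have "\<exists>S. \<forall>n. (approximate_subgroup (S n) \<and> (n = 0 \<longrightarrow> S n = A)) \<and> refines (S n) (S (Suc n))"
    unfolding refines_def using assms massicot_wagner[of _ 8] by (intro dependent_nat_choice) auto
  then show thesis
    using that unfolding refines_def by metis
qed

lemma halving_sequence_of_chain:
  assumes "\<And>n. approximate_subgroup (S n)"
    and "\<And>n. iterated_sumset 8 (S (Suc n)) \<subseteq> iterated_sumset 4 (S n)"
  shows "halving_sequence (\<lambda>n. iterated_sumset 4 (S n))"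
proof
  show "0 \<in> iterated_sumset 4 (S n)" for n
    using approximate_subgroup_zero[OF assms(1)] by (rule zero_in_iterated_sumset)
  show "- x \<in> iterated_sumset 4 (S n)" if "x \<in> iterated_sumset 4 (S n)" for n x
    using approximate_subgroup_uminus[OF assms(1)] that by (rule uminus_in_iterated_sumset)
  fix n
  show "iterated_sumset 4 (S (Suc n)) + iterated_sumset 4 (S (Suc n)) \<subseteq> iterated_sumset 4 (S n)"
    using assms(2)[of n] iterated_sumset_add[of 4 4 "S (Suc n)"] by simp
qed

lemma approximate_subgroup_seminorm:
  assumes "approximate_subgroup A"
  obtains N where "group_seminorm N" "{x. N x < 1 / 2} \<subseteq> iterated_sumset 4 A"
    "seminorm_totally_bounded N A"
proof -
  obtain S where S: "S 0 = A" "\<And>n::nat. approximate_subgroup (S n)"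
    and covered_Suc: "\<And>n. covered_by_translates (S n) (S (Suc n))"
    and "\<And>n. iterated_sumset 8 (S (Suc n)) \<subseteq> iterated_sumset 4 (S n)"
    using approximate_subgroup_chain[OF assms] by blast
  define V where "V n = iterated_sumset 4 (S n)" for n
  interpret halving_sequence V
    unfolding V_def by (intro halving_sequence_of_chain) fact+
  have V_0: "V (Suc 0) \<subseteq> V 0"
    using set_zero_plus2[OF zero, of "V (Suc 0)" "Suc 0"] halving[of 0] by blast
  have covered: "covered_by_translates A (S n)" for n
  proof (induction n)
    case 0
    show ?case using S(1) by (simp add: covered_by_translates_subset)
  qed (blast intro: covered_by_translates_trans covered_Suc)
  have "covered_by_translates (S n) (V n)" for n
    using iterated_sumset_le_subset[OF approximate_subgroup_zero[OF S(2)], of 1 4 n]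
    by (intro covered_by_translates_subset) (simp add: V_def)
  then have "seminorm_totally_bounded dyadic_gauge A"
    by (intro seminorm_totally_bounded_dyadic_gauge covered_by_translates_trans[OF covered])
  moreover have "{x. dyadic_gauge x < 1 / 2} \<subseteq> iterated_sumset 4 A"
    using mem_of_dyadic_gauge_less[of _ 0] V_0 S(1) by (auto simp: V_def)
  ultimately show thesis
    using that group_seminorm_dyadic_gauge by blast
qed

section \<open>Metric groups and cut and project schemes\<close>

locale metric_ab_group = Metric_space M d
  for M :: "'h set" and d +
  fixes add :: "'h \<Rightarrow> 'h \<Rightarrow> 'h" and unit :: 'h and neg :: "'h \<Rightarrow> 'h"
  assumes add_closed: "\<And>x y. x \<in> M \<Longrightarrow> y \<in> M \<Longrightarrow> add x y \<in> M"
    and unit_closed: "unit \<in> M"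
    and neg_closed: "\<And>x. x \<in> M \<Longrightarrow> neg x \<in> M"
    and add_assoc: "\<And>x y z. x \<in> M \<Longrightarrow> y \<in> M \<Longrightarrow> z \<in> M \<Longrightarrow> add (add x y) z = add x (add y z)"
    and add_commute: "\<And>x y. x \<in> M \<Longrightarrow> y \<in> M \<Longrightarrow> add x y = add y x"
    and add_unit: "\<And>x. x \<in> M \<Longrightarrow> add unit x = x"
    and add_neg: "\<And>x. x \<in> M \<Longrightarrow> add (neg x) x = unit"
    and d_add_le: "\<And>x y x' y'. x \<in> M \<Longrightarrow> y \<in> M \<Longrightarrow> x' \<in> M \<Longrightarrow> y' \<in> M \<Longrightarrow>
      d (add x y) (add x' y') \<le> d x x' + d y y'"
    and d_neg_le: "\<And>x y. x \<in> M \<Longrightarrow> y \<in> M \<Longrightarrow> d (neg x) (neg y) \<le> d x y"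
begin

lemma continuous_map_add:
  "continuous_map (prod_topology mtopology mtopology) mtopology (\<lambda>(x, y). add x y)"
  unfolding continuous_map_to_metric
proof (intro ballI allI impI)
  fix p and e :: real assume "p \<in> topspace (prod_topology mtopology mtopology)" "e > 0"
  then obtain x y where p: "p = (x, y)" "x \<in> M" "y \<in> M" by auto
  let ?U = "mball x (e / 2) \<times> mball y (e / 2)"
  have "add x' y' \<in> mball (add x y) e" if "(x', y') \<in> ?U" for x' y'
    using that d_add_le[of x y x' y'] add_closed by auto
  moreover have "openin (prod_topology mtopology mtopology) ?U"
    by (simp add: openin_prod_Times_iff)
  moreover have "(x, y) \<in> ?U" using p \<open>e > 0\<close> by simp
  ultimately show "\<exists>U. openin (prod_topology mtopology mtopology) U \<and> p \<in> U \<and>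
      (\<forall>q\<in>U. (case q of (x, y) \<Rightarrow> add x y) \<in> mball (case p of (x, y) \<Rightarrow> add x y) e)"
    unfolding p(1) by (intro exI[of _ ?U]) auto
qed

lemma continuous_map_neg: "continuous_map mtopology mtopology neg"
  unfolding continuous_map_to_metric
proof (intro ballI allI impI)
  fix x and e :: real assume "x \<in> topspace mtopology" "e > 0"
  moreover have "neg y \<in> mball (neg x) e" if "y \<in> mball x e" for y
    using that d_neg_le[of x y] neg_closed by auto
  ultimately show "\<exists>U. openin mtopology U \<and> x \<in> U \<and> (\<forall>y\<in>U. neg y \<in> mball (neg x) e)"
    by (intro exI[of _ "mball x e"]) auto
qed

lemma compactin_add_neg_image:
  assumes "compactin mtopology X" "compactin mtopology Y"
  shows "compactin mtopology ((\<lambda>(x, y). add x y) ` (X \<times> neg ` Y))"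
  using assms continuous_map_add continuous_map_neg
  by (intro image_compactin) (auto simp: compactin_Times intro: image_compactin)

lemma lca_group_mtopology:
  assumes "locally_compact_space mtopology"
  shows "lca_group mtopology add unit neg"
  using assms add_closed unit_closed neg_closed add_assoc add_commute add_unit add_neg
    continuous_map_add continuous_map_neg
  by (simp add: lca_group_def Hausdorff_space_mtopology)

lemma add_neg_add_cancel: "x \<in> M \<Longrightarrow> y \<in> M \<Longrightarrow> add (add x (neg y)) y = x"
  using add_assoc[of x "neg y" y] add_neg[of y] add_unit[of x] add_commute[of x unit]
    neg_closed unit_closed by simp

end

lemma (in Metric_space) mtotally_bounded_of_nets:
  assumes "S \<subseteq> M" and nets: "\<And>e. e > 0 \<Longrightarrow> \<exists>K. finite K \<and> S \<subseteq> (\<Union>x\<in>K. mball x e)"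
  shows "mtotally_bounded S"
  unfolding mtotally_bounded_def
proof (intro allI impI)
  fix e :: real assume "e > 0"
  then obtain K where K: "finite K" "S \<subseteq> (\<Union>x\<in>K. mball x (e / 2))" using nets[of "e / 2"] by auto
  define K' where "K' = {x \<in> K. S \<inter> mball x (e / 2) \<noteq> {}}"
  have "\<forall>x\<in>K'. \<exists>y. y \<in> S \<inter> mball x (e / 2)" by (auto simp: K'_def)
  then obtain s where s: "\<And>x. x \<in> K' \<Longrightarrow> s x \<in> S \<inter> mball x (e / 2)" by metis
  have "y \<in> (\<Union>x\<in>s ` K'. mball x e)" if "y \<in> S" for y
  proof -
    obtain x where x: "x \<in> K" "y \<in> mball x (e / 2)" using K(2) \<open>y \<in> S\<close> by blast
    then have "x \<in> K'" using \<open>y \<in> S\<close> by (auto simp: K'_def)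
    then have "d (s x) y < e"
      using s[of x] x(2) triangle[of "s x" x y] commute[of x "s x"] by auto
    then show ?thesis using s[OF \<open>x \<in> K'\<close>] x(2) \<open>x \<in> K'\<close> by auto
  qed
  then show "\<exists>K. finite K \<and> K \<subseteq> S \<and> S \<subseteq> (\<Union>x\<in>K. mball x e)"
  proof (intro exI conjI)
    show "finite (s ` K')" using K(1) by (simp add: K'_def)
    show "s ` K' \<subseteq> S" using s by blast
  qed blast
qed

locale seminorm_completion = metric_ab_group M d add unit neg
  for M :: "'h set" and d add unit neg +
  fixes \<phi> :: "'a::ab_group_add \<Rightarrow> 'h" and N :: "'a \<Rightarrow> real"
  assumes complete: "mcomplete"
    and hom_closed: "\<And>x. \<phi> x \<in> M"
    and hom_zero: "\<phi> 0 = unit"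
    and hom_add: "\<And>x y. \<phi> (x + y) = add (\<phi> x) (\<phi> y)"
    and hom_uminus: "\<And>x. \<phi> (- x) = neg (\<phi> x)"
    and d_hom: "\<And>x y. d (\<phi> x) (\<phi> y) = N (x - y)"
    and hom_dense: "\<And>h e. h \<in> M \<Longrightarrow> e > 0 \<Longrightarrow> \<exists>x. d h (\<phi> x) < e"
begin

abbreviation graph :: "('a \<times> 'h) set" where
  "graph \<equiv> range (\<lambda>x. (x, \<phi> x))"

lemma star_graph: "star graph x = \<phi> x"
proof -
  have "the_inv_into graph fst x = (x, \<phi> x)"
    by (rule the_inv_into_f_eq) (auto simp: inj_on_def)
  then show ?thesis by (simp add: star_def)
qed

lemma closure_of_range_hom: "mtopology closure_of (range \<phi>) = M"
  using hom_dense hom_closed by (force simp: metric_closure_of)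

lemma decomposition_along_hom:
  assumes "h \<in> M"
  shows "\<exists>u \<in> mcball unit (d h (\<phi> l)). add (add u (neg (\<phi> a))) (\<phi> (l + a)) = h"
proof
  define u where "u = add h (neg (\<phi> l))"
  have u: "u \<in> M" "add u (\<phi> l) = h"
    using assms add_neg_add_cancel add_closed neg_closed hom_closed by (simp_all add: u_def)
  have "d unit u = d (add h (neg (\<phi> l))) (add (\<phi> l) (neg (\<phi> l)))"
    using add_commute add_neg neg_closed hom_closed by (simp add: u_def commute)
  also have "\<dots> \<le> d h (\<phi> l)"
    using d_add_le[of h "neg (\<phi> l)" "\<phi> l" "neg (\<phi> l)"] assms neg_closed hom_closed by simp
  finally show "u \<in> mcball unit (d h (\<phi> l))"
    using u(1) unit_closed by simp
  have "add (add u (neg (\<phi> a))) (\<phi> (a + l)) = add (add (add u (neg (\<phi> a))) (\<phi> a)) (\<phi> l)"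
    using u(1) add_closed neg_closed hom_closed by (simp add: hom_add add_assoc)
  then show "add (add u (neg (\<phi> a))) (\<phi> (l + a)) = h"
    using u add_neg_add_cancel hom_closed by (simp add: add.commute)
qed

text \<open>\<open>(g, h) = (k, (h - \<phi> l) - \<phi> a) + (l + a, \<phi> (l + a))\<close> whenever \<open>g - l = a + k\<close>.\<close>

lemma translates_of_graph_cover:
  assumes "{x + k | x k. x \<in> \<Lambda> \<and> k \<in> K} = UNIV" "s > 0" "h \<in> M"
  shows "\<exists>k\<in>K. \<exists>u\<in>mcball unit s. \<exists>a\<in>\<Lambda>. \<exists>x. g = k + x \<and> h = add (add u (neg (\<phi> a))) (\<phi> x)"
proof -
  obtain l where l: "d h (\<phi> l) < s" using hom_dense[OF assms(3,2)] by blast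
  have "g - l \<in> {x + k | x k. x \<in> \<Lambda> \<and> k \<in> K}" using assms(1) by simp
  then obtain a k where "a \<in> \<Lambda>" "k \<in> K" "g - l = a + k" by blast
  moreover obtain u where "u \<in> mcball unit (d h (\<phi> l))" "add (add u (neg (\<phi> a))) (\<phi> (l + a)) = h"
    using decomposition_along_hom[OF assms(3)] by blast
  moreover from this have "u \<in> mcball unit s" using l by auto
  moreover have "g = k + (l + a)" using \<open>g - l = a + k\<close> by (simp add: algebra_simps)
  ultimately show ?thesis by metis
qed

lemma mtotally_bounded_hom_image:
  assumes "seminorm_totally_bounded N A"
  shows "mtotally_bounded (\<phi> ` A)"
proof (rule mtotally_bounded_of_nets)
  fix e :: real assume "e > 0"
  then have "e / 2 > 0" by simp
  then obtain Z where Z: "finite Z" "\<forall>a\<in>A. \<exists>z\<in>Z. N (a - z) \<le> e / 2"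
    using assms unfolding seminorm_totally_bounded_def by blast
  have "\<exists>z\<in>Z. d (\<phi> z) (\<phi> a) < e" if "a \<in> A" for a
  proof -
    obtain z where "z \<in> Z" "N (a - z) \<le> e / 2" using Z(2) \<open>a \<in> A\<close> by blast
    then show ?thesis
      using d_hom[of a z] commute[of "\<phi> a" "\<phi> z"] \<open>e > 0\<close> by (intro bexI[of _ z]) auto
  qed
  then show "\<exists>K. finite K \<and> \<phi> ` A \<subseteq> (\<Union>x\<in>K. mball x e)"
    using Z(1) hom_closed by (intro exI[of _ "\<phi> ` Z"]) auto
qed (use hom_closed in auto)

lemma mcball_subset_closure_of_hom_image:
  assumes "d h (\<phi> x) + s < r"
  shows "mcball h s \<subseteq> mtopology closure_of (\<phi> ` ({a. N a < r} + {x}))"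
proof
  fix y assume "y \<in> mcball h s"
  then have y: "y \<in> M" "h \<in> M" "d h y \<le> s" by auto
  have "\<exists>z \<in> \<phi> ` ({a. N a < r} + {x}). z \<in> M \<and> d y z < e" if "e > 0" for e
  proof -
    define \<delta> where "\<delta> = min e (r - (d h (\<phi> x) + s))"
    have "\<delta> > 0" using assms that by (simp add: \<delta>_def)
    then obtain g where g: "d y (\<phi> g) < \<delta>" using hom_dense[OF y(1)] by blast
    have "N (g - x) = d (\<phi> g) (\<phi> x)" by (simp add: d_hom)
    also have "\<dots> \<le> d (\<phi> g) y + (d y h + d h (\<phi> x))"
      using triangle[OF hom_closed[of g] y(1) hom_closed[of x]] triangle[OF y(1,2) hom_closed[of x]]
      by linarith
    also have "\<dots> < r"
      using g y(3) commute[of y "\<phi> g"] commute[of h y] by (simp add: \<delta>_def)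
    finally have "g - x + x \<in> {a. N a < r} + {x}"
      by (intro set_plus_intro) auto
    then have "\<phi> g \<in> \<phi> ` ({a. N a < r} + {x})" by simp
    then show ?thesis
      using g hom_closed by (intro bexI[of _ "\<phi> g"]) (simp_all add: \<delta>_def)
  qed
  then show "y \<in> mtopology closure_of (\<phi> ` ({a. N a < r} + {x}))"
    using y(1) unfolding metric_closure_of by simp
qed

lemma compactin_mcball:
  assumes "seminorm_totally_bounded N {a. N a < r}" "h \<in> M" "s < r"
  shows "compactin mtopology (mcball h s)"
proof -
  obtain x where x: "d h (\<phi> x) < r - s"
    using hom_dense[OF assms(2), of "r - s"] assms(3) by auto
  have "seminorm_totally_bounded N ({a. N a < r} + {x})"
    using covered_by_translates_plus_finite assms(1)
    by (rule seminorm_totally_bounded_covered) simp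
  then have "mtotally_bounded (mtopology closure_of (\<phi> ` ({a. N a < r} + {x})))"
    by (intro mtotally_bounded_closure_of mtotally_bounded_hom_image)
  moreover have "mcball h s \<subseteq> mtopology closure_of (\<phi> ` ({a. N a < r} + {x}))"
    using x by (intro mcball_subset_closure_of_hom_image) simp
  ultimately have "mtotally_bounded (mcball h s)"
    by (rule mtotally_bounded_subset)
  then show ?thesis
    using mtotally_bounded_eq_compact_closure_of[OF complete] by (simp add: closure_of_closedin)
qed

lemma locally_compact_space_mtopology:
  assumes "seminorm_totally_bounded N {a. N a < r}" "r > 0"
  shows "locally_compact_space mtopology"
  unfolding locally_compact_space_def
proof
  fix h assume "h \<in> topspace mtopology"
  then show "\<exists>U K. openin mtopology U \<and> compactin mtopology K \<and> h \<in> U \<and> U \<subseteq> K"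
    using compactin_mcball[OF assms(1), of h "r / 2"] assms(2)
    by (intro exI[of _ "mball h (r / 2)"] exI[of _ "mcball h (r / 2)"]) auto
qed

definition window :: "real \<Rightarrow> 'a set \<Rightarrow> 'h set" where
  "window s \<Lambda> = \<phi> ` \<Lambda> \<union> mball unit s"

lemma subset_model_set_window: "\<Lambda> \<subseteq> model_set graph (window s \<Lambda>)"
  by (auto simp: model_set_def window_def star_graph image_iff)

lemma compactin_closure_of_window:
  assumes "seminorm_totally_bounded N {a. N a < r}" "s < r" "seminorm_totally_bounded N \<Lambda>"
  shows "compactin mtopology (mtopology closure_of (window s \<Lambda>))"
proof -
  have "mtotally_bounded (mcball unit s)"
    using compactin_mcball[OF assms(1) unit_closed assms(2)]
    by (rule compactin_imp_mtotally_bounded)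
  then have "mtotally_bounded (mball unit s)"
    by (rule mtotally_bounded_subset) auto
  then have "mtotally_bounded (window s \<Lambda>)"
    unfolding window_def by (intro mtotally_bounded_Un mtotally_bounded_hom_image assms(3))
  then show ?thesis
    using mtotally_bounded_eq_compact_closure_of[OF complete] by blast
qed

lemma window_admissible:
  assumes "seminorm_totally_bounded N {a. N a < r}" "0 < s" "s < r" "seminorm_totally_bounded N \<Lambda>"
  shows "admissible_window mtopology (window s \<Lambda>)"
  unfolding admissible_window_def
proof (intro conjI)
  show "window s \<Lambda> \<subseteq> topspace mtopology"
    using hom_closed by (auto simp: window_def)
  show "compactin mtopology (mtopology closure_of (window s \<Lambda>))"
    using assms by (intro compactin_closure_of_window)
  have "mball unit s \<subseteq> mtopology interior_of (window s \<Lambda>)"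
    by (intro interior_of_maximal) (auto simp: window_def)
  then show "mtopology interior_of (window s \<Lambda>) \<noteq> {}"
    using unit_closed \<open>0 < s\<close> by (metis centre_in_mball_iff empty_iff subsetD)
qed

end

lemma locally_finite_set_covered:
  fixes A B :: "'a::topological_ab_group_add set"
  assumes "covered_by_translates A B" "locally_finite_set B"
  shows "locally_finite_set A"
  unfolding locally_finite_set_def
proof (intro allI impI)
  fix K :: "'a set" assume "compact K"
  obtain F where F: "finite F" "A \<subseteq> B + F"
    using assms(1) by (auto simp: covered_by_translates_def)
  have "finite (B \<inter> (\<lambda>x. x - f) ` K)" for f
  proof -
    have "compact ((\<lambda>x. x - f) ` K)"
      using \<open>compact K\<close> by (intro compact_continuous_image continuous_intros)
    then show ?thesis using assms(2) by (simp add: locally_finite_set_def)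
  qed
  then have "finite (\<Union>f\<in>F. (\<lambda>x. x + f) ` (B \<inter> (\<lambda>x. x - f) ` K))"
    using F(1) by blast
  moreover have "A \<inter> K \<subseteq> (\<Union>f\<in>F. (\<lambda>x. x + f) ` (B \<inter> (\<lambda>x. x - f) ` K))"
  proof
    fix k assume k: "k \<in> A \<inter> K"
    then obtain b f where "b \<in> B" "f \<in> F" "k = b + f"
      using subsetD[OF F(2), of k] by (auto elim: set_plus_elim)
    moreover from this have "b = k - f" by simp
    ultimately show "k \<in> (\<Union>f\<in>F. (\<lambda>x. x + f) ` (B \<inter> (\<lambda>x. x - f) ` K))"
      using k by blast
  qed
  ultimately show "finite (A \<inter> K)" by (rule rev_finite_subset)
qed

locale locally_finite_completion = seminorm_completion M d add unit neg \<phi> N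
  for M :: "'h set" and d add unit neg
    and \<phi> :: "'a::{topological_ab_group_add, t2_space} \<Rightarrow> 'h" and N +
  fixes r :: real
  assumes r_pos: "r > 0"
    and ball_totally_bounded: "seminorm_totally_bounded N {a. N a < r}"
    and ball_locally_finite: "locally_finite_set {a. N a < r}"
begin

lemma graph_isolated:
  assumes "compact K" "open V" "x \<in> V" "V \<subseteq> K"
  shows "\<exists>T. openin (prod_topology euclidean mtopology) T \<and> T \<inter> graph = {(x, \<phi> x)}"
proof -
  define E where "E = ({a. N a < r} + {x}) \<inter> K - {x}"
  have "locally_finite_set ({a. N a < r} + {x})"
    using covered_by_translates_plus_finite ball_locally_finite
    by (rule locally_finite_set_covered) simp
  then have "finite E"
    using \<open>compact K\<close> by (simp add: E_def locally_finite_set_def)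
  then have "openin (prod_topology euclidean mtopology) ((V - E) \<times> mball (\<phi> x) r)"
    using \<open>open V\<close> by (simp add: openin_prod_Times_iff open_Diff finite_imp_closed)
  moreover have "y = x" if "y \<in> V - E" "\<phi> y \<in> mball (\<phi> x) r" for y
  proof -
    have "N (y - x) < r" using that(2) d_hom[of y x] commute[of "\<phi> x" "\<phi> y"] by simp
    then have "y - x + x \<in> {a. N a < r} + {x}" by (intro set_plus_intro) auto
    then show ?thesis using that(1) \<open>V \<subseteq> K\<close> by (auto simp: E_def)
  qed
  moreover have "x \<in> V - E" "\<phi> x \<in> mball (\<phi> x) r"
    using \<open>x \<in> V\<close> r_pos hom_closed by (auto simp: E_def)
  ultimately show ?thesis
    by (intro exI[of _ "(V - E) \<times> mball (\<phi> x) r"]) blast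
qed

lemma graph_discrete:
  assumes "locally_compact_space (euclidean :: 'a topology)"
  shows "subtopology (prod_topology euclidean mtopology) graph = discrete_topology graph"
proof (rule subtopology_eq_discrete_topology, intro conjI)
  show "graph \<subseteq> topspace (prod_topology euclidean mtopology)" using hom_closed by auto
  have "(x, \<phi> x) \<notin> prod_topology euclidean mtopology derived_set_of graph" for x
  proof -
    obtain V K where "compact K" "open V" "x \<in> V" "V \<subseteq> K"
      using assms[unfolded locally_compact_space_def, rule_format, of x] by auto
    then obtain T where "openin (prod_topology euclidean mtopology) T" "T \<inter> graph = {(x, \<phi> x)}"
      using graph_isolated[of K V x] by blast
    then show ?thesis unfolding in_derived_set_of by blast
  qed
  then show "graph \<inter> prod_topology euclidean mtopology derived_set_of graph = {}" by auto
qed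

lemma graph_cocompact:
  assumes "relatively_dense \<Lambda>" "seminorm_totally_bounded N \<Lambda>"
  shows "\<exists>K. compactin (prod_topology euclidean mtopology) K \<and>
    {(fst k + fst l, add (snd k) (snd l)) | k l. k \<in> K \<and> l \<in> graph} = UNIV \<times> topspace mtopology"
proof -
  obtain K where K: "compact K" "{x + k | x k. x \<in> \<Lambda> \<and> k \<in> K} = UNIV"
    using assms(1) by (auto simp: relatively_dense_def)
  define C where "C = (\<lambda>(x, y). add x y) `
    (mcball unit (r / 2) \<times> neg ` (mtopology closure_of (\<phi> ` \<Lambda>)))"
  have "compactin mtopology C"
    unfolding C_def
  proof (rule compactin_add_neg_image)
    show "compactin mtopology (mcball unit (r / 2))"
      using r_pos by (intro compactin_mcball[OF ball_totally_bounded unit_closed]) simp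
    show "compactin mtopology (mtopology closure_of (\<phi> ` \<Lambda>))"
      using mtotally_bounded_hom_image[OF assms(2)]
        mtotally_bounded_eq_compact_closure_of[OF complete] by blast
  qed
  then have "compactin (prod_topology euclidean mtopology) (K \<times> C)"
    using K(1) by (simp add: compactin_Times)
  moreover have "{(fst k + fst l, add (snd k) (snd l)) | k l. k \<in> K \<times> C \<and> l \<in> graph}
      = UNIV \<times> topspace mtopology"
  proof (intro equalityI subsetI)
    fix p assume "p \<in> {(fst k + fst l, add (snd k) (snd l)) | k l. k \<in> K \<times> C \<and> l \<in> graph}"
    then show "p \<in> UNIV \<times> topspace mtopology"
      using compactin_subset_topspace[OF \<open>compactin mtopology C\<close>] add_closed hom_closed by auto
  next
    fix p :: "'a \<times> 'h" assume "p \<in> UNIV \<times> topspace mtopology"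
    then obtain g h where "p = (g, h)" "h \<in> M" by auto
    then obtain k u a x where "k \<in> K" "u \<in> mcball unit (r / 2)" "a \<in> \<Lambda>"
      "p = (k + x, add (add u (neg (\<phi> a))) (\<phi> x))"
      using translates_of_graph_cover[OF K(2), of "r / 2" h g] r_pos by auto
    moreover from this have "add u (neg (\<phi> a)) \<in> C"
      using hom_closed closure_of_subset[of "\<phi> ` \<Lambda>" mtopology] by (force simp: C_def)
    ultimately show "p \<in> {(fst k + fst l, add (snd k) (snd l)) | k l. k \<in> K \<times> C \<and> l \<in> graph}"
      by (intro CollectI exI[of _ "(k, add u (neg (\<phi> a)))"] exI[of _ "(x, \<phi> x)"]) auto
  qed
  ultimately show ?thesis by blast
qed

theorem cut_and_project_graph:
  assumes "locally_compact_space (euclidean :: 'a topology)"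
    and "relatively_dense \<Lambda>" "seminorm_totally_bounded N \<Lambda>"
  shows "cut_and_project mtopology add unit neg graph"
  unfolding cut_and_project_def
proof (intro conjI)
  show "lca_group mtopology add unit neg"
    using ball_totally_bounded r_pos by (intro lca_group_mtopology locally_compact_space_mtopology)
  show "subtopology (prod_topology euclidean mtopology) graph = discrete_topology graph"
    using assms(1) by (rule graph_discrete)
  show "\<exists>K. compactin (prod_topology euclidean mtopology) K \<and>
    {(fst k + fst l, add (snd k) (snd l)) | k l. k \<in> K \<and> l \<in> graph} = UNIV \<times> topspace mtopology"
    using assms(2,3) by (rule graph_cocompact)
  show "mtopology closure_of (snd ` graph) = topspace mtopology"
    using closure_of_range_hom by (simp add: image_image)
qed (use hom_closed in \<open>auto simp: inj_on_def image_iff hom_zero hom_add hom_uminus\<close>)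

end

section \<open>Completion of a seminormed group\<close>

definition uniformly_close :: "real \<Rightarrow> ('a \<Rightarrow> real) \<Rightarrow> ('a \<Rightarrow> real) \<Rightarrow> bool" where
  "uniformly_close e f g \<longleftrightarrow> (\<forall>y. \<bar>f y - g y\<bar> \<le> e)"

lemma uniformly_close_refl: "uniformly_close 0 f f"
  by (simp add: uniformly_close_def)

lemma uniformly_close_sym: "uniformly_close e f g \<Longrightarrow> uniformly_close e g f"
  by (simp add: uniformly_close_def abs_minus_commute)

lemma uniformly_close_trans:
  assumes "uniformly_close a f g" "uniformly_close b g h"
  shows "uniformly_close (a + b) f h"
  unfolding uniformly_close_def
proof
  fix y
  have "\<bar>f y - g y\<bar> \<le> a" "\<bar>g y - h y\<bar> \<le> b" using assms by (auto simp: uniformly_close_def)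
  then show "\<bar>f y - h y\<bar> \<le> a + b" by linarith
qed

lemma uniformly_close_imp_eq:
  assumes "\<And>e. e > 0 \<Longrightarrow> uniformly_close e f g"
  shows "f = g"
proof
  fix y
  have "\<bar>f y - g y\<bar> \<le> 0"
  proof (rule field_le_epsilon)
    fix e :: real assume "e > 0"
    from assms[OF this] show "\<bar>f y - g y\<bar> \<le> 0 + e" by (simp add: uniformly_close_def)
  qed
  then show "f y = g y" by simp
qed

context group_seminorm
begin

text \<open>A point \<open>h\<close> of the completion is represented by its distance function \<open>y \<mapsto> d(h, y)\<close>
  on the group; in these terms the sum of two points is an infimal convolution.\<close>

definition dist_fun :: "'a \<Rightarrow> 'a \<Rightarrow> real" where
  "dist_fun x y = N (x - y)"

definition completion :: "('a \<Rightarrow> real) set" where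
  "completion = {f. \<forall>e>0. \<exists>x. uniformly_close e f (dist_fun x)}"

definition inf_conv :: "('a \<Rightarrow> real) \<Rightarrow> ('a \<Rightarrow> real) \<Rightarrow> 'a \<Rightarrow> real" where
  "inf_conv f g y = (INF z. f z + g (y - z))"

definition reflect :: "('a \<Rightarrow> real) \<Rightarrow> 'a \<Rightarrow> real" where
  "reflect f y = f (- y)"

definition sup_dist :: "('a \<Rightarrow> real) \<Rightarrow> ('a \<Rightarrow> real) \<Rightarrow> real" where
  "sup_dist f g = (if f \<in> completion \<and> g \<in> completion then SUP y. \<bar>f y - g y\<bar> else 0)"

lemma minus_commute: "N (x - y) = N (y - x)"
  using uminus[of "x - y"] by simp

lemma minus_triangle: "N (x - z) \<le> N (x - y) + N (y - z)"
  using add_le[of "x - y" "y - z"] by simp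

lemma uniformly_close_dist_fun: "uniformly_close (N (x - y)) (dist_fun x) (dist_fun y)"
  unfolding uniformly_close_def dist_fun_def
proof
  fix z
  show "\<bar>N (x - z) - N (y - z)\<bar> \<le> N (x - y)"
    using minus_triangle[of x z y] minus_triangle[of y z x] minus_commute[of x y] by linarith
qed

lemma completionE:
  assumes "f \<in> completion" "e > 0"
  obtains x where "uniformly_close e f (dist_fun x)"
  using assms by (auto simp: completion_def)

lemma completion_eqI:
  assumes "\<And>e. e > 0 \<Longrightarrow> \<exists>x. uniformly_close e f (dist_fun x) \<and> uniformly_close e g (dist_fun x)"
  shows "f = g"
proof (rule uniformly_close_imp_eq)
  fix e :: real assume "e > 0"
  then have "e / 2 > 0" by simp
  then obtain x where
    "uniformly_close (e / 2) f (dist_fun x)" "uniformly_close (e / 2) g (dist_fun x)"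
    using assms by blast
  then show "uniformly_close e f g"
    using uniformly_close_trans uniformly_close_sym by fastforce
qed

lemma dist_fun_in_completion: "dist_fun x \<in> completion"
  by (auto simp: completion_def uniformly_close_def intro!: exI[of _ x])

lemma completion_closed:
  assumes "\<And>e. e > 0 \<Longrightarrow> \<exists>g\<in>completion. uniformly_close e f g"
  shows "f \<in> completion"
  unfolding completion_def
proof (intro CollectI allI impI)
  fix e :: real assume "e > 0"
  then have "e / 2 > 0" by simp
  then obtain g x where "uniformly_close (e / 2) f g" "uniformly_close (e / 2) g (dist_fun x)"
    using assms by (meson completionE)
  then show "\<exists>x. uniformly_close e f (dist_fun x)"
    using uniformly_close_trans by fastforce
qed

lemma uniformly_close_dist_fun_self:
  assumes "f \<in> completion"
  shows "uniformly_close (f y) f (dist_fun y)"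
  unfolding uniformly_close_def
proof
  fix z
  show "\<bar>f z - dist_fun y z\<bar> \<le> f y"
  proof (rule field_le_epsilon)
    fix e :: real assume "e > 0"
    then have "e / 2 > 0" by simp
    with assms obtain x where "uniformly_close (e / 2) f (dist_fun x)" by (rule completionE)
    then have "\<bar>f z - dist_fun x z\<bar> \<le> e / 2" "\<bar>f y - dist_fun x y\<bar> \<le> e / 2"
      by (auto simp: uniformly_close_def)
    moreover have "\<bar>dist_fun x z - dist_fun y z\<bar> \<le> dist_fun x y"
      using uniformly_close_dist_fun[of x y] by (simp add: uniformly_close_def dist_fun_def)
    ultimately show "\<bar>f z - dist_fun y z\<bar> \<le> f y + e" by linarith
  qed
qed

lemma completion_nonneg: "f \<in> completion \<Longrightarrow> 0 \<le> f y"
  using uniformly_close_dist_fun_self[of f y] by (meson abs_ge_zero order_trans uniformly_close_def)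

lemma inf_conv_le:
  assumes "f \<in> completion" "g \<in> completion"
  shows "inf_conv f g y \<le> f z + g (y - z)"
  unfolding inf_conv_def
proof (rule cINF_lower)
  show "bdd_below (range (\<lambda>z. f z + g (y - z)))"
    using completion_nonneg assms by (intro bdd_belowI[of _ 0]) (auto intro: add_nonneg_nonneg)
qed simp

lemma le_inf_conv: "(\<And>z. c \<le> f z + g (y - z)) \<Longrightarrow> c \<le> inf_conv f g y"
  unfolding inf_conv_def by (rule cINF_greatest) auto

lemma inf_conv_dist_fun: "inf_conv (dist_fun x) (dist_fun y) = dist_fun (x + y)"
proof (rule ext, rule antisym)
  fix w
  show "inf_conv (dist_fun x) (dist_fun y) w \<le> dist_fun (x + y) w"
    using inf_conv_le[OF dist_fun_in_completion dist_fun_in_completion, of x y w x]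
    by (simp add: dist_fun_def zero algebra_simps)
  show "dist_fun (x + y) w \<le> inf_conv (dist_fun x) (dist_fun y) w"
  proof (rule le_inf_conv)
    fix z
    show "dist_fun (x + y) w \<le> dist_fun x z + dist_fun y (w - z)"
      using add_le[of "x - z" "y - (w - z)"] by (simp add: dist_fun_def algebra_simps)
  qed
qed

lemma uniformly_close_inf_conv:
  assumes "f \<in> completion" "g \<in> completion" "f' \<in> completion" "g' \<in> completion"
    and "uniformly_close a f f'" "uniformly_close b g g'"
  shows "uniformly_close (a + b) (inf_conv f g) (inf_conv f' g')"
proof -
  have one_sided: "inf_conv f g y - (a + b) \<le> inf_conv f' g' y"
    if "f \<in> completion" "g \<in> completion" "uniformly_close a f f'" "uniformly_close b g g'"
    for f g f' g' y
  proof (rule le_inf_conv)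
    fix z
    have "\<bar>f z - f' z\<bar> \<le> a" "\<bar>g (y - z) - g' (y - z)\<bar> \<le> b"
      using that by (auto simp: uniformly_close_def)
    then show "inf_conv f g y - (a + b) \<le> f' z + g' (y - z)"
      using inf_conv_le[OF that(1,2), of y z] by linarith
  qed
  have "\<bar>inf_conv f g y - inf_conv f' g' y\<bar> \<le> a + b" for y
    using one_sided[OF assms(1,2,5,6), of y]
      one_sided[OF assms(3,4) assms(5,6)[THEN uniformly_close_sym], of y] by linarith
  then show ?thesis by (simp add: uniformly_close_def)
qed

lemma uniformly_close_inf_conv_dist_fun:
  assumes "f \<in> completion" "g \<in> completion"
    and "uniformly_close a f (dist_fun x)" "uniformly_close b g (dist_fun y)"
  shows "uniformly_close (a + b) (inf_conv f g) (dist_fun (x + y))"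
  unfolding inf_conv_dist_fun[symmetric]
  by (intro uniformly_close_inf_conv assms dist_fun_in_completion)

lemma inf_conv_in_completion:
  assumes "f \<in> completion" "g \<in> completion"
  shows "inf_conv f g \<in> completion"
  unfolding completion_def
proof (intro CollectI allI impI)
  fix e :: real assume "e > 0"
  then have "e / 2 > 0" by simp
  then obtain x y where
    "uniformly_close (e / 2) f (dist_fun x)" "uniformly_close (e / 2) g (dist_fun y)"
    using assms by (meson completionE)
  then show "\<exists>x. uniformly_close e (inf_conv f g) (dist_fun x)"
    using uniformly_close_inf_conv_dist_fun[OF assms] by fastforce
qed

lemma inf_conv_commute:
  assumes "f \<in> completion" "g \<in> completion"
  shows "inf_conv f g = inf_conv g f"
proof (rule completion_eqI)
  fix e :: real assume "e > 0"
  then have "e / 2 > 0" by simp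
  then obtain x y where
    "uniformly_close (e / 2) f (dist_fun x)" "uniformly_close (e / 2) g (dist_fun y)"
    using assms by (meson completionE)
  then have "uniformly_close (e / 2 + e / 2) (inf_conv f g) (dist_fun (x + y))"
    "uniformly_close (e / 2 + e / 2) (inf_conv g f) (dist_fun (y + x))"
    using assms by (simp_all only: uniformly_close_inf_conv_dist_fun)
  then show "\<exists>x. uniformly_close e (inf_conv f g) (dist_fun x) \<and>
      uniformly_close e (inf_conv g f) (dist_fun x)"
    by (auto simp: add.commute)
qed

lemma inf_conv_assoc:
  assumes "f \<in> completion" "g \<in> completion" "h \<in> completion"
  shows "inf_conv (inf_conv f g) h = inf_conv f (inf_conv g h)"
proof (rule completion_eqI)
  fix e :: real assume "e > 0"
  then have "e / 3 > 0" by simp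
  then obtain x y z where
    "uniformly_close (e / 3) f (dist_fun x)" "uniformly_close (e / 3) g (dist_fun y)"
    "uniformly_close (e / 3) h (dist_fun z)"
    using assms by (meson completionE)
  then have
    "uniformly_close (e / 3 + e / 3 + e / 3) (inf_conv (inf_conv f g) h) (dist_fun (x + y + z))"
    "uniformly_close (e / 3 + (e / 3 + e / 3)) (inf_conv f (inf_conv g h)) (dist_fun (x + (y + z)))"
    using assms by (simp_all only: uniformly_close_inf_conv_dist_fun inf_conv_in_completion)
  then show "\<exists>x. uniformly_close e (inf_conv (inf_conv f g) h) (dist_fun x) \<and>
      uniformly_close e (inf_conv f (inf_conv g h)) (dist_fun x)"
    by (auto simp: add.assoc)
qed

lemma inf_conv_unit:
  assumes "f \<in> completion"
  shows "inf_conv (dist_fun 0) f = f"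
proof (rule completion_eqI)
  fix e :: real assume "e > 0"
  with assms obtain x where x: "uniformly_close e f (dist_fun x)" by (rule completionE)
  have "uniformly_close (0 + e) (inf_conv (dist_fun 0) f) (dist_fun (0 + x))"
    by (intro uniformly_close_inf_conv_dist_fun dist_fun_in_completion uniformly_close_refl assms x)
  then show "\<exists>x. uniformly_close e (inf_conv (dist_fun 0) f) (dist_fun x) \<and>
      uniformly_close e f (dist_fun x)"
    using x by auto
qed

lemma uniformly_close_reflect: "uniformly_close e f g \<Longrightarrow> uniformly_close e (reflect f) (reflect g)"
  by (simp add: uniformly_close_def reflect_def)

lemma reflect_dist_fun: "reflect (dist_fun x) = dist_fun (- x)"
proof
  fix y
  show "reflect (dist_fun x) y = dist_fun (- x) y"
    using uminus[of "x + y"] by (simp add: reflect_def dist_fun_def)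
qed

lemma reflect_in_completion: "f \<in> completion \<Longrightarrow> reflect f \<in> completion"
  unfolding completion_def using uniformly_close_reflect reflect_dist_fun by fastforce

lemma inf_conv_reflect:
  assumes "f \<in> completion"
  shows "inf_conv (reflect f) f = dist_fun 0"
proof (rule completion_eqI)
  fix e :: real assume "e > 0"
  then have "e / 2 > 0" by simp
  with assms obtain x where x: "uniformly_close (e / 2) f (dist_fun x)" by (rule completionE)
  have "uniformly_close (e / 2 + e / 2) (inf_conv (reflect f) f) (dist_fun (- x + x))"
    using uniformly_close_reflect[OF x] assms x
    by (intro uniformly_close_inf_conv_dist_fun reflect_in_completion)
      (simp_all add: reflect_dist_fun)
  then show "\<exists>x. uniformly_close e (inf_conv (reflect f) f) (dist_fun x) \<and>
      uniformly_close e (dist_fun 0) (dist_fun x)"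
    using \<open>e > 0\<close> by (intro exI[of _ 0]) (simp add: uniformly_close_def)
qed

lemma sup_dist_le_iff:
  assumes "f \<in> completion" "g \<in> completion"
  shows "sup_dist f g \<le> e \<longleftrightarrow> uniformly_close e f g"
proof -
  have "uniformly_close (f 0 + g 0) f g"
    using uniformly_close_dist_fun_self[OF assms(1), of 0]
      uniformly_close_dist_fun_self[OF assms(2), of 0, THEN uniformly_close_sym]
    by (rule uniformly_close_trans)
  then have "bdd_above (range (\<lambda>y. \<bar>f y - g y\<bar>))"
    by (intro bdd_aboveI) (auto simp: uniformly_close_def)
  then show ?thesis
    using assms by (simp add: sup_dist_def cSUP_le_iff uniformly_close_def)
qed

lemma uniformly_close_sup_dist:
  "f \<in> completion \<Longrightarrow> g \<in> completion \<Longrightarrow> uniformly_close (sup_dist f g) f g"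
  using sup_dist_le_iff by blast

lemma sup_dist_dist_fun:
  assumes "f \<in> completion"
  shows "sup_dist f (dist_fun x) = f x"
proof (rule antisym)
  show "sup_dist f (dist_fun x) \<le> f x"
    using uniformly_close_dist_fun_self[OF assms]
    by (simp add: sup_dist_le_iff assms dist_fun_in_completion)
  have "\<bar>f x - dist_fun x x\<bar> \<le> sup_dist f (dist_fun x)"
    using uniformly_close_sup_dist[OF assms dist_fun_in_completion, of x]
    by (simp add: uniformly_close_def)
  then show "f x \<le> sup_dist f (dist_fun x)" by (simp add: dist_fun_def zero)
qed

lemma Metric_space_completion: "Metric_space completion sup_dist"
proof
  show nonneg: "0 \<le> sup_dist f g" for f g
  proof (cases "f \<in> completion \<and> g \<in> completion")
    case True
    then have "\<bar>f 0 - g 0\<bar> \<le> sup_dist f g"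
      using uniformly_close_sup_dist by (simp add: uniformly_close_def)
    then show ?thesis by linarith
  qed (auto simp: sup_dist_def)
  show "sup_dist f g = sup_dist g f" for f g
    by (simp add: sup_dist_def abs_minus_commute conj_commute)
  show "sup_dist f g = 0 \<longleftrightarrow> f = g" if "f \<in> completion" "g \<in> completion" for f g
  proof -
    have "sup_dist f g = 0 \<longleftrightarrow> uniformly_close 0 f g"
      using sup_dist_le_iff[OF that, of 0] nonneg[of f g] by auto
    also have "\<dots> \<longleftrightarrow> f = g" by (auto simp: uniformly_close_def)
    finally show ?thesis .
  qed
  show "sup_dist f h \<le> sup_dist f g + sup_dist g h"
    if "f \<in> completion" "g \<in> completion" "h \<in> completion" for f g h
    unfolding sup_dist_le_iff[OF that(1,3)]
    using uniformly_close_sup_dist[OF that(1,2)] uniformly_close_sup_dist[OF that(2,3)]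
    by (rule uniformly_close_trans)
qed

lemma uniformly_Cauchy_of_sup_dist:
  assumes "\<And>n. \<sigma> n \<in> completion"
    and cauchy: "\<And>e. e > 0 \<Longrightarrow> \<exists>k. \<forall>m n. k \<le> m \<longrightarrow> k \<le> n \<longrightarrow> sup_dist (\<sigma> m) (\<sigma> n) < e"
  shows "uniformly_Cauchy_on UNIV \<sigma>"
  unfolding uniformly_Cauchy_on_def
proof (intro allI impI)
  fix e :: real assume "e > 0"
  then obtain k where k: "\<forall>m n. k \<le> m \<longrightarrow> k \<le> n \<longrightarrow> sup_dist (\<sigma> m) (\<sigma> n) < e"
    using cauchy by blast
  have "dist (\<sigma> m y) (\<sigma> n y) < e" if "m \<ge> k" "n \<ge> k" for m n y
  proof -
    have "\<bar>\<sigma> m y - \<sigma> n y\<bar> \<le> sup_dist (\<sigma> m) (\<sigma> n)"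
      using uniformly_close_sup_dist[OF assms(1,1)] by (simp add: uniformly_close_def)
    then show ?thesis using k that by (fastforce simp: dist_real_def)
  qed
  then show "\<exists>M. \<forall>y\<in>UNIV. \<forall>m\<ge>M. \<forall>n\<ge>M. dist (\<sigma> m y) (\<sigma> n y) < e" by blast
qed

lemma mcomplete_completion: "Metric_space.mcomplete completion sup_dist"
proof -
  interpret Metric_space completion sup_dist by (rule Metric_space_completion)
  have "\<exists>f. limitin mtopology \<sigma> f sequentially" if "MCauchy \<sigma>" for \<sigma>
  proof -
    have \<sigma>: "\<sigma> n \<in> completion" for n
      using \<open>MCauchy \<sigma>\<close> by (auto simp: MCauchy_def)
    then have "uniformly_Cauchy_on UNIV \<sigma>"
      using \<open>MCauchy \<sigma>\<close> by (intro uniformly_Cauchy_of_sup_dist) (simp_all add: MCauchy_def)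
    then obtain f where limit: "uniform_limit UNIV \<sigma> f sequentially"
      using Cauchy_uniformly_convergent unfolding uniformly_convergent_on_def by blast
    have close: "\<forall>\<^sub>F n in sequentially. uniformly_close e (\<sigma> n) f" if "e > 0" for e
      using uniform_limitD[OF limit that] unfolding uniformly_close_def
      by eventually_elim (simp add: dist_real_def less_imp_le)
    have f: "f \<in> completion"
    proof (rule completion_closed)
      fix e :: real assume "e > 0"
      then obtain n where "uniformly_close e (\<sigma> n) f"
        using eventually_happens[OF close] by auto
      then show "\<exists>g\<in>completion. uniformly_close e f g"
        using \<sigma> uniformly_close_sym by blast
    qed
    have "\<forall>\<^sub>F n in sequentially. \<sigma> n \<in> completion \<and> sup_dist (\<sigma> n) f < e" if "e > 0" for e
      using close[of "e / 2"] that
      by (auto simp: \<sigma> simp flip: sup_dist_le_iff[OF \<sigma> f] elim!: eventually_mono)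
    then show ?thesis
      using f unfolding limitin_metric by blast
  qed
  then show ?thesis unfolding mcomplete_def by blast
qed

theorem completion_is_seminorm_completion:
  "seminorm_completion completion sup_dist inf_conv (dist_fun 0) reflect dist_fun N"
proof -
  interpret Metric_space completion sup_dist by (rule Metric_space_completion)
  show ?thesis
  proof
    show "mcomplete" by (rule mcomplete_completion)
    show "inf_conv f g = inf_conv g f" if "f \<in> completion" "g \<in> completion" for f g
      using that by (rule inf_conv_commute)
    show "sup_dist (inf_conv f g) (inf_conv f' g') \<le> sup_dist f f' + sup_dist g g'"
      if "f \<in> completion" "g \<in> completion" "f' \<in> completion" "g' \<in> completion" for f g f' g'
      using that by (simp add: sup_dist_le_iff inf_conv_in_completion uniformly_close_inf_conv
          uniformly_close_sup_dist)
    show "sup_dist (reflect f) (reflect g) \<le> sup_dist f g"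
      if "f \<in> completion" "g \<in> completion" for f g
      using that by (simp add: sup_dist_le_iff reflect_in_completion uniformly_close_reflect
          uniformly_close_sup_dist)
    show "sup_dist (dist_fun x) (dist_fun y) = N (x - y)" for x y
      by (simp add: sup_dist_dist_fun dist_fun_in_completion) (simp add: dist_fun_def)
    show "\<exists>x. sup_dist f (dist_fun x) < e" if "f \<in> completion" "e > 0" for f e
    proof -
      have "e / 2 > 0" using that(2) by simp
      with that(1) obtain x where "uniformly_close (e / 2) f (dist_fun x)" by (rule completionE)
      then have "sup_dist f (dist_fun x) \<le> e / 2"
        by (simp only: sup_dist_le_iff[OF that(1) dist_fun_in_completion])
      then show ?thesis using \<open>e > 0\<close> by (intro exI[of _ x]) linarith
    qed
  qed (simp_all add: dist_fun_in_completion inf_conv_in_completion reflect_in_completion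
      inf_conv_assoc inf_conv_unit inf_conv_reflect inf_conv_dist_fun reflect_dist_fun)
qed

text \<open>The sublevel sets of its distance function determine a point, which lets the completion
  live on the type \<open>'a set set\<close>.\<close>

definition sublevel_sets :: "('a \<Rightarrow> real) \<Rightarrow> 'a set set" where
  "sublevel_sets f = {{y. f y < r} | r. r > 0}"

lemma inj_on_sublevel_sets: "inj_on sublevel_sets completion"
proof (rule inj_onI, rule completion_eqI)
  fix f g and e :: real
  assume f: "f \<in> completion" and g: "g \<in> completion"
    and eq: "sublevel_sets f = sublevel_sets g" and "e > 0"
  have "{y. f y < e} \<in> sublevel_sets f"
    unfolding sublevel_sets_def using \<open>e > 0\<close> by blast
  then obtain r where r: "r > 0" "{y. f y < e} = {y. g y < r}"
    unfolding eq by (auto simp: sublevel_sets_def)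
  have "min r e / 2 > 0" using r(1) \<open>e > 0\<close> by simp
  with g obtain x where "uniformly_close (min r e / 2) g (dist_fun x)" by (rule completionE)
  then have "sup_dist g (dist_fun x) \<le> min r e / 2"
    by (simp only: sup_dist_le_iff[OF g dist_fun_in_completion])
  then have "g x < r" "g x \<le> e"
    using r(1) \<open>e > 0\<close> by (auto simp: sup_dist_dist_fun[OF g] min_def split: if_splits)
  moreover from this have "f x \<le> e" using r(2) by (auto simp: set_eq_iff less_imp_le)
  ultimately show "\<exists>x. uniformly_close e f (dist_fun x) \<and> uniformly_close e g (dist_fun x)"
    using sup_dist_dist_fun sup_dist_le_iff dist_fun_in_completion f g by metis
qed

end

section \<open>Transport of structure\<close>

context Metric_space
begin

lemma Metric_space_transport:
  assumes "inj_on c M"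
  shows "Metric_space (c ` M) (\<lambda>p q. d (inv_into M c p) (inv_into M c q))"
  by standard (use assms in \<open>auto simp: commute triangle\<close>)

lemma mcomplete_transport:
  assumes "inj_on c M" "mcomplete"
  shows "Metric_space.mcomplete (c ` M) (\<lambda>p q. d (inv_into M c p) (inv_into M c q))"
proof -
  let ?e = "\<lambda>p q. d (inv_into M c p) (inv_into M c q)"
  interpret C: Metric_space "c ` M" ?e
    using assms(1) by (rule Metric_space_transport)
  show ?thesis
    unfolding C.mcomplete_def
  proof (intro allI impI)
    fix \<sigma> assume "C.MCauchy \<sigma>"
    then have \<sigma>: "\<sigma> n \<in> c ` M" for n
      by (auto simp: C.MCauchy_def)
    from \<open>C.MCauchy \<sigma>\<close> have "MCauchy (inv_into M c \<circ> \<sigma>)"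
      unfolding MCauchy_def C.MCauchy_def by (auto intro!: inv_into_into)
    then obtain x where x: "limitin mtopology (inv_into M c \<circ> \<sigma>) x sequentially"
      using assms(2) by (auto simp: mcomplete_def)
    then have "limitin C.mtopology \<sigma> (c x) sequentially"
      using \<sigma> assms(1) inv_into_into[OF \<sigma>] by (simp add: limitin_metric C.limitin_metric)
    then show "\<exists>p. limitin C.mtopology \<sigma> p sequentially" by blast
  qed
qed

end

lemma (in seminorm_completion) seminorm_completion_transport:
  assumes "inj_on c M"
  defines "c' \<equiv> inv_into M c"
  shows "seminorm_completion (c ` M) (\<lambda>p q. d (c' p) (c' q)) (\<lambda>p q. c (add (c' p) (c' q)))
    (c unit) (\<lambda>p. c (neg (c' p))) (\<lambda>x. c (\<phi> x)) N"
proof -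
  have c' [simp]: "c' (c h) = h" if "h \<in> M" for h
    using assms(1) that by (simp add: c'_def)
  interpret C: Metric_space "c ` M" "\<lambda>p q. d (c' p) (c' q)"
    unfolding c'_def using assms(1) by (rule Metric_space_transport)
  show ?thesis
  proof
    show "C.mcomplete"
      unfolding c'_def using assms(1) complete by (rule mcomplete_transport)
    show "\<exists>x. d (c' p) (c' (c (\<phi> x))) < e" if "p \<in> c ` M" "e > 0" for p e
      using that hom_dense hom_closed by auto
    show "c (add (c' p) (c' q)) = c (add (c' q) (c' p))" if "p \<in> c ` M" "q \<in> c ` M" for p q
      using that add_commute by auto
  qed (auto simp: add_closed unit_closed neg_closed hom_closed add_assoc add_unit add_neg
      d_add_le d_neg_le hom_zero hom_add hom_uminus d_hom)
qed

lemma (in group_seminorm) set_set_completion_exists: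
  "\<exists>M d add unit neg (\<phi> :: 'a \<Rightarrow> 'a set set). seminorm_completion M d add unit neg \<phi> N"
  using completion_is_seminorm_completion inj_on_sublevel_sets
  by (blast dest: seminorm_completion.seminorm_completion_transport)

section \<open>Almost lattices\<close>

lemma almost_lattice_difference_set_covered:
  assumes "almost_lattice \<Lambda>"
  shows "covered_by_translates (difference_set \<Lambda>) \<Lambda>"
  using assms unfolding almost_lattice_def difference_set_def covered_by_translates_def
  by (fastforce simp: set_plus_def)

lemma almost_lattice_nonempty: "almost_lattice \<Lambda> \<Longrightarrow> \<Lambda> \<noteq> {}"
  by (auto simp: almost_lattice_def relatively_dense_def)

lemma covered_by_difference_set:
  assumes "\<Lambda> \<noteq> {}"
  shows "covered_by_translates \<Lambda> (difference_set \<Lambda>)"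
proof -
  obtain c where "c \<in> \<Lambda>" using assms by blast
  have "x \<in> difference_set \<Lambda> + {c}" if "x \<in> \<Lambda>" for x
    using set_plus_intro[OF difference_setI[OF that \<open>c \<in> \<Lambda>\<close>], of c "{c}"] by simp
  then show ?thesis unfolding covered_by_translates_def by blast
qed

lemma almost_lattice_seminorm:
  fixes \<Lambda> :: "'a::topological_ab_group_add set"
  assumes "almost_lattice \<Lambda>"
  obtains N r where "group_seminorm N" "r > 0" "locally_finite_set {a. N a < r}"
    "seminorm_totally_bounded N {a. N a < r}" "seminorm_totally_bounded N \<Lambda>"
proof -
  let ?A = "difference_set \<Lambda>"
  have covered: "covered_by_translates ?A \<Lambda>" "covered_by_translates \<Lambda> ?A"
    and A: "approximate_subgroup ?A"
    using almost_lattice_difference_set_covered[OF assms] almost_lattice_nonempty[OF assms]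
    by (simp_all add: covered_by_difference_set approximate_subgroup_difference_set)
  obtain N where N: "group_seminorm N" "{a. N a < 1 / 2} \<subseteq> iterated_sumset 4 ?A"
    "seminorm_totally_bounded N ?A"
    using approximate_subgroup_seminorm[OF A] by blast
  have ball_covered: "covered_by_translates {a. N a < 1 / 2} ?A"
    using covered_by_translates_subset[OF N(2)] iterated_sumset_covered[OF A]
    by (rule covered_by_translates_trans)
  show thesis
  proof
    show "group_seminorm N" "(1 / 2 :: real) > 0" using N(1) by simp_all
    show "locally_finite_set {a. N a < 1 / 2}"
      using covered_by_translates_trans[OF ball_covered covered(1)] assms
      by (auto simp: almost_lattice_def intro: locally_finite_set_covered)
    show "seminorm_totally_bounded N {a. N a < 1 / 2}" "seminorm_totally_bounded N \<Lambda>"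
      using seminorm_totally_bounded_covered N(3) ball_covered covered(2) by blast+
  qed
qed

theorem theorem7p4:
  fixes \<Lambda> :: "'a::{topological_ab_group_add, t2_space} set"
  assumes "locally_compact_space (euclidean :: 'a topology)"
    and "sigma_compact_group TYPE('a)"
    and "almost_lattice \<Lambda>"
  shows "\<exists>(T :: 'a set set topology) add zero neg (L :: ('a \<times> 'a set set) set) W.
           cut_and_project T add zero neg L \<and> admissible_window T W \<and>
           \<Lambda> \<subseteq> model_set L W"
proof -
  obtain N r where N: "group_seminorm N" "r > 0" "locally_finite_set {a. N a < r}"
    "seminorm_totally_bounded N {a. N a < r}" and \<Lambda>: "seminorm_totally_bounded N \<Lambda>"
    using almost_lattice_seminorm[OF assms(3)] by blast
  obtain M d add unit neg and \<phi> :: "'a \<Rightarrow> 'a set set"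
    where "seminorm_completion M d add unit neg \<phi> N"
    using group_seminorm.set_set_completion_exists[OF N(1)] by blast
  with N interpret locally_finite_completion M d add unit neg \<phi> N r
    by (simp add: locally_finite_completion_def locally_finite_completion_axioms_def)
  have "cut_and_project mtopology add unit neg graph"
    using assms(1,3) \<Lambda> by (intro cut_and_project_graph) (simp_all add: almost_lattice_def)
  moreover have "admissible_window mtopology (window (r / 2) \<Lambda>)"
    using r_pos by (intro window_admissible[OF ball_totally_bounded _ _ \<Lambda>]) simp_all
  ultimately show ?thesis
    using subset_model_set_window by blast
qed

end
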